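(* Let $F:\mathbb{C}^2\to\mathbb{C}^2$ be given by $F(z,w)=(e^{-(z+w)}+z+w,\ e^{-2w}+2w+1)$. For $\alpha>1$ let $L_\alpha=\{(z,w)\in\mathbb{C}^2:\operatorname{Re}w>\operatorname{Re}z+\alpha,\ \operatorname{Re}z>1,\ \operatorname{Re}w>1\}$, let $L=\bigcup_{\alpha>1}L_\alpha$, and let $U$ be the invariant Fatou component of $F$ containing $L$. Then $L$ is an absorbing domain for $U$, that is, $$U=\bigcup_{n\in\mathbb{N}}F^{-n}(L).$$
   Context: View $\mathbb{C}^2$ as a subset of $\mathbb{P}^2(\mathbb{C})$ via $(z,w)\mapsto[z:w:1]$. The Fatou set of $F$ is the largest open subset of $\mathbb{C}^2$ on which the family of iterates $\{F^n\}_{n\in\mathbb{N}}$ is normal (every sequence of iterates has a subsequence converging uniformly on compact subsets as maps into $\mathbb{P}^2(\mathbb{C})$). A Fatou component is a connected component of the Fatou set. *)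

theory Defs
  imports "HOL-Analysis.Analysis" "HOL-Library.Diagonal_Subsequence"
begin

section \<open>The complex projective plane\<close>

definition proportional :: "complex^3 \<Rightarrow> complex^3 \<Rightarrow> bool" where
  "proportional u v \<longleftrightarrow> u \<noteq> 0 \<and> v \<noteq> 0 \<and> (\<exists>c. v = c *s u)"

quotient_type proj_plane = "complex^3" / partial: proportional
proof (rule part_equivpI)
  have "proportional (vec 1) (vec 1)"
    unfolding proportional_def by (auto simp: vec_eq_iff intro!: exI[of _ 1])
  then show "\<exists>v. proportional v v" ..
  show "symp proportional"
  proof (rule sympI)
    fix u v :: "complex^3" assume "proportional u v"
    then obtain c where *: "u \<noteq> 0" "v \<noteq> 0" "v = c *s u" by (auto simp: proportional_def)
    then have "c \<noteq> 0" by auto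
    then have "u = (1/c) *s v" using * by (simp add: vec_eq_iff)
    then show "proportional v u" using * unfolding proportional_def by blast
  qed
  show "transp proportional"
    by (rule transpI) (auto simp: proportional_def vector_smult_assoc)
qed

(* The matrix of the orthogonal projection of \<complex>\<^sup>3 onto the line spanned by u. *)
definition line_proj :: "complex^3 \<Rightarrow> complex^3^3" where
  "line_proj u = (\<chi> i j. u $ i * cnj (u $ j) / of_real ((norm u)\<^sup>2))"

lemma norm_sq_vec: "complex_of_real ((norm u)\<^sup>2) = (\<Sum>i\<in>UNIV. cnj (u $ i) * u $ i)"
  for u :: "complex^'n"
  by (simp add: norm_vec_def L2_set_def sum_nonneg complex_norm_square mult.commute
        flip: of_real_power)

lemma line_proj_mult:
  "line_proj u *v v = ((\<Sum>j\<in>UNIV. cnj (u $ j) * v $ j) / of_real ((norm u)\<^sup>2)) *s u"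
  by (simp add: line_proj_def matrix_vector_mult_def vec_eq_iff sum_divide_distrib
        sum_distrib_right sum_distrib_left mult_ac)

lemma line_proj_self: "u \<noteq> 0 \<Longrightarrow> line_proj u *v u = u"
  by (simp add: line_proj_mult norm_sq_vec[symmetric])

lemma line_proj_eq_imp_proportional:
  assumes "u \<noteq> 0" "v \<noteq> 0" "line_proj u = line_proj v"
  shows "proportional u v"
proof -
  have "v = line_proj u *v v" using assms line_proj_self by metis
  then show ?thesis unfolding line_proj_mult proportional_def using assms by blast
qed

lemma line_proj_scale: "c \<noteq> 0 \<Longrightarrow> line_proj (c *s u) = line_proj u"
proof -
  assume c: "c \<noteq> 0"
  have "complex_of_real ((norm (c *s u))\<^sup>2) = c * cnj c * of_real ((norm u)\<^sup>2)"
    by (simp add: norm_sq_vec sum_distrib_left mult_ac del: of_real_power)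
  then show ?thesis using c
    by (simp add: line_proj_def vec_eq_iff del: of_real_power)
qed

lift_definition pmat :: "proj_plane \<Rightarrow> complex^3^3" is line_proj
  by (auto simp: proportional_def) (metis line_proj_scale vector_smult_lzero)

lemma pmat_inject: "pmat p = pmat q \<Longrightarrow> p = q"
proof transfer
  fix u v assume "proportional u u" "proportional v v" "line_proj u = line_proj v"
  then show "proportional u v"
    by (intro line_proj_eq_imp_proportional) (simp_all add: proportional_def)
qed

(* A point is identified with the orthogonal projection onto the corresponding line; up to a
   constant factor the resulting metric is the chordal (Fubini--Study) metric
   sqrt (1 - |<u,v>|\<^sup>2 / (|u|\<^sup>2 |v|\<^sup>2)). It induces the quotient topology, see
   open_proj_plane_iff below. *)
instantiation proj_plane :: metric_space
begin

definition dist_proj_plane :: "proj_plane \<Rightarrow> proj_plane \<Rightarrow> real" where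
  "dist_proj_plane p q = dist (pmat p) (pmat q)"

definition uniformity_proj_plane :: "(proj_plane \<times> proj_plane) filter" where
  "uniformity_proj_plane = (INF e\<in>{0<..}. principal {(p, q). dist p q < e})"

definition open_proj_plane :: "proj_plane set \<Rightarrow> bool" where
  "open_proj_plane U \<longleftrightarrow> (\<forall>p\<in>U. \<forall>\<^sub>F (p', q) in uniformity. p' = p \<longrightarrow> q \<in> U)"

instance
proof
  fix p q r :: proj_plane
  show "dist p q = 0 \<longleftrightarrow> p = q"
    by (auto simp: dist_proj_plane_def dest: pmat_inject)
  show "dist p q \<le> dist p r + dist q r"
    by (simp add: dist_proj_plane_def dist_triangle2)
qed (simp_all add: uniformity_proj_plane_def open_proj_plane_def)

end

lemma norm_matrix_vector_mult_le: "norm (A *v x) \<le> norm A * norm x"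
  for A :: "complex^'n^'m"
proof -
  have "norm ((A *v x) $ i) \<le> norm (A $ i) * norm x" for i
  proof -
    have "norm ((A *v x) $ i) \<le> (\<Sum>j\<in>UNIV. \<bar>norm (A $ i $ j)\<bar> * \<bar>norm (x $ j)\<bar>)"
      unfolding matrix_vector_mult_def by (auto intro!: sum_norm_le simp: norm_mult)
    also have "\<dots> \<le> norm (A $ i) * norm x"
      unfolding norm_vec_def by (rule L2_set_mult_ineq)
    finally show ?thesis .
  qed
  then have "norm (A *v x) \<le> L2_set (\<lambda>i. norm x * norm (A $ i)) UNIV"
    unfolding norm_vec_def[of "A *v x"] by (intro L2_set_mono) (auto simp: mult.commute)
  also have "\<dots> = norm x * norm A"
    unfolding norm_vec_def[of A] by (rule L2_set_right_distrib[symmetric]) simp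
  finally show ?thesis by (simp add: mult.commute)
qed

lemma pmat_abs: "u \<noteq> 0 \<Longrightarrow> pmat (abs_proj_plane u) = line_proj u"
  by (rule pmat.abs_eq) (auto simp: proportional_def intro!: exI[of _ 1])

lemma abs_proj_plane_cases:
  obtains u where "u \<noteq> 0" "p = abs_proj_plane u"
  using Quotient_proj_plane unfolding Quotient_def proportional_def by metis

lemma abs_proj_plane_scale:
  assumes "u \<noteq> 0" "c *s u \<noteq> 0"
  shows "abs_proj_plane (c *s u) = abs_proj_plane u"
proof (rule pmat_inject)
  have "c \<noteq> 0" using assms by auto
  then show "pmat (abs_proj_plane (c *s u)) = pmat (abs_proj_plane u)"
    using assms by (simp add: pmat_abs line_proj_scale)
qed

lemma continuous_on_abs_proj_plane: "continuous_on (- {0}) abs_proj_plane"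
proof -
  have "continuous_on (- {0}) line_proj"
    unfolding line_proj_def by (intro continuous_intros) auto
  then have "continuous_on (- {0}) (\<lambda>u. pmat (abs_proj_plane u))"
    by (rule continuous_on_eq) (simp add: pmat_abs)
  then show ?thesis by (simp add: continuous_on_iff dist_proj_plane_def)
qed

lemma open_proj_plane_iff:
  "open U \<longleftrightarrow> open {v. v \<noteq> 0 \<and> abs_proj_plane v \<in> U}" (is "_ \<longleftrightarrow> open ?V")
proof
  assume "open U"
  then have "open (abs_proj_plane -` U \<inter> - {0})"
    using continuous_on_abs_proj_plane by (subst (asm) continuous_on_open_vimage) auto
  moreover have "abs_proj_plane -` U \<inter> - {0} = ?V" by auto
  ultimately show "open ?V" by simp
next
  assume V: "open ?V"
  show "open U" unfolding open_dist
  proof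
    fix p assume "p \<in> U"
    obtain v where v: "v \<noteq> 0" "p = abs_proj_plane v" by (rule abs_proj_plane_cases)
    with \<open>p \<in> U\<close> V obtain e where e: "e > 0" "\<And>w. dist w v < e \<Longrightarrow> w \<in> ?V"
      unfolding open_dist by blast
    have "q \<in> U" if q: "dist q p < e / norm v" for q
    proof -
      obtain u where u: "u \<noteq> 0" "q = abs_proj_plane u" by (rule abs_proj_plane_cases)
      define w where "w = line_proj u *v v"
      have "w - v = (line_proj u - line_proj v) *v v"
        using v by (simp add: w_def matrix_vector_mult_diff_rdistrib line_proj_self)
      then have "dist w v \<le> dist q p * norm v"
        using norm_matrix_vector_mult_le[of "line_proj u - line_proj v" v] u v
        by (simp add: dist_norm dist_proj_plane_def pmat_abs)
      also have "\<dots> < e" using q v by (simp add: pos_less_divide_eq)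
      finally have "w \<in> ?V" by (rule e)
      then show ?thesis using u abs_proj_plane_scale[of u] by (auto simp: w_def line_proj_mult)
    qed
    moreover have "e / norm v > 0" using e v by simp
    ultimately show "\<exists>e>0. \<forall>q. dist q p < e \<longrightarrow> q \<in> U" by blast
  qed
qed

section \<open>Normality and Fatou components\<close>

lift_definition embed :: "complex \<times> complex \<Rightarrow> proj_plane" is "\<lambda>(z, w). vector [z, w, 1]"
  by (auto simp: proportional_def vec_eq_iff forall_3 vector_3 intro!: exI[of _ 1])

definition normal_on :: "'a::topological_space set \<Rightarrow> ('a \<Rightarrow> 'b::metric_space) set \<Rightarrow> bool" where
  "normal_on V \<F> \<longleftrightarrow>
     (\<forall>f. range f \<subseteq> \<F> \<longrightarrow>
       (\<exists>r :: nat \<Rightarrow> nat. strict_mono r \<and>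
         (\<exists>g. \<forall>K. compact K \<and> K \<subseteq> V \<longrightarrow> uniform_limit K (\<lambda>n. f (r n)) g sequentially)))"

definition iterates :: "(complex \<times> complex \<Rightarrow> complex \<times> complex) \<Rightarrow> (complex \<times> complex \<Rightarrow> proj_plane) set"
  where "iterates F = range (\<lambda>n. embed \<circ> F ^^ n)"

definition fatou_set :: "(complex \<times> complex \<Rightarrow> complex \<times> complex) \<Rightarrow> (complex \<times> complex) set" where
  "fatou_set F = \<Union> {V. open V \<and> normal_on V (iterates F)}"

lemma normal_on_Union:
  fixes \<C> :: "'a::{heine_borel,second_countable_topology} set set"
  assumes C: "\<And>V. V \<in> \<C> \<Longrightarrow> open V" "\<And>V. V \<in> \<C> \<Longrightarrow> normal_on V \<F>"
  shows "normal_on (\<Union>\<C>) \<F>"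
  unfolding normal_on_def
proof (intro allI impI)
  fix f :: "nat \<Rightarrow> 'a \<Rightarrow> 'b" assume f: "range f \<subseteq> \<F>"
  obtain \<D> where D: "\<D> \<subseteq> \<C>" "countable \<D>" "\<Union>\<D> = \<Union>\<C>"
    using Lindelof[of \<C>] C by metis
  show "\<exists>r :: nat \<Rightarrow> nat. strict_mono r \<and> (\<exists>g. \<forall>K. compact K \<and> K \<subseteq> \<Union>\<C> \<longrightarrow>
    uniform_limit K (\<lambda>n. f (r n)) g sequentially)"
  proof (cases "\<D> = {}")
    case True
    then have "\<Union>\<C> = {}" using D by auto
    then have "uniform_limit K (\<lambda>n. f (id n)) undefined sequentially" if "K \<subseteq> \<Union>\<C>" for K
      using that by (intro uniform_limitI always_eventually) blast
    then show ?thesis using strict_mono_id by blast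
  next
    case False
    define W where "W = from_nat_into \<D>"
    have W: "open (W k)" "normal_on (W k) \<F>" for k
      using from_nat_into[OF False] D(1) C by (auto simp: W_def)
    have UW: "(\<Union>k. W k) = \<Union>\<C>"
      using range_from_nat_into[OF False D(2)] D(3) by (simp add: W_def)
    define P where "P = (\<lambda>k s. \<exists>g. \<forall>K. compact K \<and> K \<subseteq> W k \<longrightarrow>
      uniform_limit K (\<lambda>n. f (s n)) g sequentially)"
    interpret subseqs P
    proof
      fix k and s :: "nat \<Rightarrow> nat"
      have "range (f \<circ> s) \<subseteq> \<F>" using f by auto
      then show "\<exists>r'. strict_mono r' \<and> P k (s \<circ> r')"
        using W(2)[of k, unfolded normal_on_def, rule_format, of "f \<circ> s"] by (simp add: P_def)
    qed
    have P_sub: "P k (s \<circ> r)" if r: "strict_mono r" and s: "P k s" for k and r s :: "nat \<Rightarrow> nat"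
    proof -
      obtain g where g: "\<forall>K. compact K \<and> K \<subseteq> W k \<longrightarrow> uniform_limit K (\<lambda>n. f (s n)) g sequentially"
        using s unfolding P_def by (rule exE)
      have "uniform_limit K (\<lambda>n. f ((s \<circ> r) n)) g sequentially" if "compact K \<and> K \<subseteq> W k" for K
        using filterlim_compose[OF g[rule_format, OF that] filterlim_subseq[OF r]] by simp
      then show ?thesis unfolding P_def by (intro exI[of _ g] allI impI)
    qed
    have "P k diagseq" for k
    proof -
      have "P k (diagseq \<circ> ((+) (Suc k)))" by (rule diagseq_holds[OF P_sub])
      then obtain g where g: "\<forall>K. compact K \<and> K \<subseteq> W k \<longrightarrow>
          uniform_limit K (\<lambda>n. f ((diagseq \<circ> (+) (Suc k)) n)) g sequentially"
        unfolding P_def by (rule exE)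
      have "uniform_limit K (\<lambda>n. f (diagseq n)) g sequentially" if "compact K \<and> K \<subseteq> W k" for K
      proof (rule uniform_limitI)
        fix e :: real assume "e > 0"
        with g[rule_format, OF that]
        have "\<forall>\<^sub>F n in sequentially. \<forall>x\<in>K. dist (f (diagseq (n + Suc k)) x) (g x) < e"
          unfolding uniform_limit_iff comp_apply by (simp only: add.commute)
        then show "\<forall>\<^sub>F n in sequentially. \<forall>x\<in>K. dist (f (diagseq n) x) (g x) < e"
          by (rule eventually_sequentially_seg[THEN iffD1])
      qed
      then show ?thesis unfolding P_def by (intro exI[of _ g] allI impI)
    qed
    then have "\<exists>G. \<forall>k K. compact K \<and> K \<subseteq> W k \<longrightarrow>
        uniform_limit K (\<lambda>n. f (diagseq n)) (G k) sequentially"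
      unfolding P_def by (intro choice allI)
    then obtain G where G: "\<And>k K. compact K \<Longrightarrow> K \<subseteq> W k \<Longrightarrow>
        uniform_limit K (\<lambda>n. f (diagseq n)) (G k) sequentially"
      by blast
    define g where "g = (\<lambda>x. lim (\<lambda>n. f (diagseq n) x))"
    have g: "g x = G k x" if "x \<in> W k" for x k
      using G[of "{x}" k] that unfolding g_def by (intro limI) simp
    have g_lim: "uniform_limit K (\<lambda>n. f (diagseq n)) g sequentially"
      if "compact K" "K \<subseteq> W k" for K k
      using G[OF that] g that(2)
      by (subst uniform_limit_cong'[of K _ "\<lambda>n. f (diagseq n)" _ "G k"]) auto
    have "uniform_limit K (\<lambda>n. f (diagseq n)) g sequentially"
      if K: "compact K" "K \<subseteq> \<Union>\<C>" for K
    proof -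
      have "\<exists>k e. 0 < e \<and> cball x e \<subseteq> W k" if x: "x \<in> K" for x
      proof -
        have "x \<in> (\<Union>k. W k)" unfolding UW using x K(2) by (rule rev_subsetD)
        then obtain k where "x \<in> W k" by (rule UN_E)
        then show ?thesis using W(1)[of k] open_contains_cball by blast
      qed
      then obtain \<kappa> \<epsilon> where e: "\<And>x. x \<in> K \<Longrightarrow> 0 < \<epsilon> x \<and> cball x (\<epsilon> x) \<subseteq> W (\<kappa> x)"
        by metis
      have "K \<subseteq> (\<Union>x\<in>K. ball x (\<epsilon> x))" using e by force
      then obtain X where X: "X \<subseteq> K" "finite X" "K \<subseteq> (\<Union>x\<in>X. ball x (\<epsilon> x))"
        using compactE_image[OF K(1), of K "\<lambda>x. ball x (\<epsilon> x)"] by auto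
      show ?thesis
      proof (rule uniform_limitI)
        fix \<delta> :: real assume "\<delta> > 0"
        have "\<forall>\<^sub>F n in sequentially. \<forall>x\<in>X. \<forall>y\<in>cball x (\<epsilon> x). dist (f (diagseq n) y) (g y) < \<delta>"
          using X(1) e
          by (intro eventually_ball_finite X(2) ballI uniform_limitD[OF g_lim \<open>\<delta> > 0\<close>]) auto
        then show "\<forall>\<^sub>F n in sequentially. \<forall>y\<in>K. dist (f (diagseq n) y) (g y) < \<delta>"
          by eventually_elim (use X(3) in force)
      qed
    qed
    then show ?thesis using subseq_diagseq by blast
  qed
qed

(* The union is itself normal, so this is the largest open set on which the iterates are normal. *)
lemma normal_on_fatou_set: "normal_on (fatou_set F) (iterates F)"
  unfolding fatou_set_def by (rule normal_on_Union) blast+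

lemma open_fatou_set: "open (fatou_set F)"
  unfolding fatou_set_def by (rule open_Union) blast

lemma fatou_set_greatest: "open V \<Longrightarrow> normal_on V (iterates F) \<Longrightarrow> V \<subseteq> fatou_set F"
  unfolding fatou_set_def by (rule Union_upper) simp

definition fatou_component ::
  "(complex \<times> complex \<Rightarrow> complex \<times> complex) \<Rightarrow> (complex \<times> complex) set \<Rightarrow> bool" where
  "fatou_component F U \<longleftrightarrow> U \<in> components (fatou_set F)"

section \<open>The map and the domain\<close>

definition F_map :: "complex \<times> complex \<Rightarrow> complex \<times> complex" where
  "F_map = (\<lambda>(z, w). (exp (- (z + w)) + z + w, exp (- 2 * w) + 2 * w + 1))"

definition L_alpha :: "real \<Rightarrow> (complex \<times> complex) set" where
  "L_alpha \<alpha> = {(z, w). Re w > Re z + \<alpha> \<and> Re z > 1 \<and> Re w > 1}"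

definition L_dom :: "(complex \<times> complex) set" where
  "L_dom = (\<Union>\<alpha>\<in>{1<..}. L_alpha \<alpha>)"

end

theory Submission
  imports Defs "HOL-Complex_Analysis.Complex_Analysis"
begin

text \<open>Write \<open>k \<zeta> = \<zeta> + exp (- \<zeta>)\<close> and \<open>g w = k (2 w) + 1\<close>, so that \<open>F (z, w) = (k (z + w), g w)\<close>, and let
the basin be the union of the preimages of \<open>L\<close> under all iterates. The two inclusions have
different reasons.

The basin lies in \<open>U\<close> because it is an open connected subset of the Fatou set that meets \<open>U\<close>. It
is also the union of the preimages of the quarter-space \<open>Q = {Re z > - 1, Re w > 1}\<close>, which is
forward invariant and absorbed by \<open>L\<close>. On \<open>Q\<close> the second coordinate doubles at each step and the
difference of the coordinates grows at most linearly, so the iterates converge locally uniformly on the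
basin to \<open>[1 : 1 : 0]\<close>; hence the basin is in the Fatou set. For connectedness, the first preimage of \<open>Q\<close> is, in the
coordinates \<open>(z + w, w)\<close>, a product of superlevel sets of \<open>Re k\<close> and \<open>Re g\<close> at levels below their
critical values, which are connected by explicit paths (\<open>connected_kmap_superlevel\<close>). The further
preimages are handled by induction: \<open>F\<close> has no finite asymptotic values, since \<open>k\<close> preserves the
lines \<open>Im \<zeta> = \<pi> j\<close>, so every component of the preimage of a connected open set \<open>D\<close> maps onto \<open>D\<close>
(\<open>component_of_vimage_surj\<close>) and, if \<open>D\<close> contains \<open>Q\<close>, meets the connected first preimage of \<open>Q\<close>.

Conversely, a limit map on \<open>U\<close> is \<open>[1 : 1 : 0]\<close> on \<open>L\<close>, hence on \<open>U\<close> by the identity theorem in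
the chart \<open>(z / w, 1 / w)\<close> (\<open>component_uniform_limit\<close>). So on \<open>U\<close> the second coordinate \<open>w\<^sub>n\<close>
of the \<open>n\<close>-th iterate tends to infinity locally uniformly, and \<open>z\<^sub>n / w\<^sub>n\<close> tends to 1. The first fact forces the
orbit of \<open>w\<close> under \<open>g\<close> to enter \<open>Re w > 1\<close> (\<open>component_escapes\<close>): at a non-escaping
limit of escaping points Schottky's theorem bounds the logarithmic derivative of the iterates of
\<open>g\<close>, while \<open>g\<close> expands uniformly along orbits that stay in \<open>Re w \<le> 1\<close>. From the entry on,
\<open>Re w\<^sub>n\<close> is at least a fixed positive multiple of \<open>\<bar>w\<^sub>n\<bar>\<close>, so \<open>z\<^sub>n / w\<^sub>n\<close> near 1 makes \<open>Re z\<^sub>n\<close>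
positive and puts the orbit in \<open>Q\<close>.\<close>

section \<open>Connected preimages\<close>

lemma connected_if_points_reach_connected_subset:
  assumes "connected H" "H \<subseteq> S"
    and reach: "\<And>x. x \<in> S \<Longrightarrow> \<exists>T. connected T \<and> T \<subseteq> S \<and> x \<in> T \<and> T \<inter> H \<noteq> {}"
  shows "connected S"
proof (cases "S = {}")
  case False
  then have H: "H \<noteq> {}" using reach by blast
  obtain T where T: "\<And>x. x \<in> S \<Longrightarrow> connected (T x) \<and> T x \<subseteq> S \<and> x \<in> T x \<and> T x \<inter> H \<noteq> {}"
    using reach by metis
  have "connected (\<Union>x\<in>S. T x \<union> H)"
    using T H assms(1) by (intro connected_Union) (auto intro!: connected_Un)
  moreover have "(\<Union>x\<in>S. T x \<union> H) = S" using T assms(2) by blast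
  ultimately show ?thesis by simp
qed simp

text \<open>The hypothesis that connected sets with bounded image are bounded excludes finite asymptotic
values. It is weaker than properness, so fibres may be infinite, but it makes the map proper on
each component of the preimage of a bounded open set, and an open proper map onto a connected set is
onto. Covering the connected target by balls gives the general case.\<close>

lemma component_of_vimage_surj:
  fixes f :: "'a::euclidean_space \<Rightarrow> 'b::euclidean_space"
  assumes cont: "continuous_on UNIV f"
    and open_map: "\<And>S. open S \<Longrightarrow> open (f ` S)"
    and bdd: "\<And>S. connected S \<Longrightarrow> bounded (f ` S) \<Longrightarrow> bounded S"
    and D: "open D" "connected D"
    and C: "C \<in> components (f -` D)"
  shows "f ` C = D"
proof -
  have op: "open (f -` N)" if "open N" for N
    using continuous_on_open_vimage[of UNIV f] cont that by auto
  have conn: "connected C" "C \<noteq> {}" "C \<subseteq> f -` D" "open C"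
    using in_components_connected[OF C] in_components_nonempty[OF C] in_components_subset[OF C]
      open_components[OF op[OF D(1)] C] by simp_all
  \<comment> \<open>Over a bounded open set the bounded components are proper, hence onto.\<close>
  have local: "N \<subseteq> f ` S"
    if N: "open N" "connected N" "bounded N" and S: "S \<in> components (f -` N)" for N S
  proof -
    have S': "connected S" "S \<noteq> {}" "S \<subseteq> f -` N" "open S"
      using in_components_connected[OF S] in_components_nonempty[OF S] in_components_subset[OF S]
        open_components[OF op[OF N(1)] S] by simp_all
    then have "f ` S \<subseteq> N" by auto
    then have bS: "bounded S" using bdd[OF S'(1)] N(3) bounded_subset by blast
    have "closedin (top_of_set N) (f ` S)"
      unfolding closedin_limpt
    proof (intro conjI allI impI)
      fix y assume "y islimpt f ` S \<and> y \<in> N"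
      then have y: "y \<in> closure (f ` S)" "y \<in> N" by (auto simp: closure_def)
      have "compact (f ` closure S)"
        using bS cont by (intro compact_continuous_image) (auto intro: continuous_on_subset)
      then have "closure (f ` S) \<subseteq> f ` closure S"
        by (intro closure_minimal image_mono closure_subset compact_imp_closed)
      then obtain x where x: "x \<in> closure S" "f x = y" using y by blast
      have "connected (insert x S)"
        by (rule connected_intermediate_closure[OF S'(1)]) (use x closure_subset in auto)
      then have "insert x S \<subseteq> S"
        by (intro components_maximal[OF S]) (use S' x y in auto)
      then show "y \<in> f ` S" using x by blast
    qed (fact \<open>f ` S \<subseteq> N\<close>)
    moreover have "openin (top_of_set N) (f ` S)"
      using open_map[OF S'(4)] \<open>f ` S \<subseteq> N\<close> open_subset by blast
    ultimately have "f ` S = N"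
      using N(2) S'(2) unfolding connected_clopen by (metis image_is_empty)
    then show ?thesis by simp
  qed
  have "closedin (top_of_set D) (f ` C)"
    unfolding closedin_limpt
  proof (intro conjI allI impI)
    show sub: "f ` C \<subseteq> D" using conn by auto
    fix y assume y: "y islimpt f ` C \<and> y \<in> D"
    then obtain e where e: "e > 0" "ball y e \<subseteq> D" using D(1) open_contains_ball by blast
    then obtain x where x: "x \<in> C" "f x \<in> ball y e"
      using y by (auto simp: islimpt_approachable dist_commute)
    define S where "S = connected_component_set (f -` ball y e) x"
    have S: "S \<in> components (f -` ball y e)" unfolding S_def using x by (intro componentsI) auto
    have "S \<subseteq> C"
    proof (rule components_maximal[OF C])
      show "connected S" using S by (rule in_components_connected)
      show "S \<subseteq> f -` D" using in_components_subset[OF S] e by blast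
      have "x \<in> S" unfolding S_def using x by (simp add: connected_component_refl)
      then show "C \<inter> S \<noteq> {}" using x by blast
    qed
    moreover have "y \<in> f ` S" using local[OF _ _ _ S] e by auto
    ultimately show "y \<in> f ` C" by blast
  qed
  moreover have "openin (top_of_set D) (f ` C)"
    using open_map[OF conn(4)] conn(3) by (intro open_subset) auto
  ultimately show ?thesis
    using D(2) conn(2) unfolding connected_clopen by (metis image_is_empty)
qed

text \<open>Each component of the larger preimage maps onto \<open>D\<close>, hence meets the preimage of \<open>Q\<close>. This is the
induction step for the iterated preimages: only the first one has to be examined by hand.\<close>

lemma connected_vimage_if_connected_subvimage:
  fixes f :: "'a::euclidean_space \<Rightarrow> 'b::euclidean_space"
  assumes cont: "continuous_on UNIV f"
    and open_map: "\<And>S. open S \<Longrightarrow> open (f ` S)"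
    and bdd: "\<And>S. connected S \<Longrightarrow> bounded (f ` S) \<Longrightarrow> bounded S"
    and D: "open D" "connected D"
    and Q: "connected (f -` Q)" "Q \<noteq> {}" "Q \<subseteq> D"
  shows "connected (f -` D)"
proof (rule connected_if_points_reach_connected_subset[OF Q(1)])
  show "f -` Q \<subseteq> f -` D" using Q by auto
  fix x assume x: "x \<in> f -` D"
  define C where "C = connected_component_set (f -` D) x"
  have C: "C \<in> components (f -` D)" unfolding C_def using x by (rule componentsI)
  have "f ` C = D"
    by (rule component_of_vimage_surj[OF cont _ _ D C]) (erule open_map, erule bdd)
  then have "C \<inter> f -` Q \<noteq> {}" using Q by blast
  moreover have "x \<in> C" unfolding C_def using x by (simp add: connected_component_refl)
  ultimately show "\<exists>T. connected T \<and> T \<subseteq> f -` D \<and> x \<in> T \<and> T \<inter> f -` Q \<noteq> {}"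
    using in_components_connected[OF C] in_components_subset[OF C] by blast
qed

section \<open>The two coordinate functions\<close>

text \<open>In the coordinates \<open>(z + w, w)\<close> on the source, the map is a product of two entire functions of one
variable, and the second is conjugate by scaling and translation to the first.\<close>

definition kmap :: "complex \<Rightarrow> complex" where
  "kmap \<zeta> = \<zeta> + exp (- \<zeta>)"

definition gmap :: "complex \<Rightarrow> complex" where
  "gmap w = kmap (2 * w) + 1"

lemma F_map_eq: "F_map (z, w) = (kmap (z + w), gmap w)"
  by (simp add: F_map_def kmap_def gmap_def)

lemma kmap_holomorphic: "kmap holomorphic_on S"
  unfolding kmap_def by (intro holomorphic_intros)

lemma continuous_on_kmap [continuous_intros]: "continuous_on S f \<Longrightarrow> continuous_on S (\<lambda>x. kmap (f x))"
  unfolding kmap_def by (intro continuous_intros)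

lemma continuous_on_gmap [continuous_intros]: "continuous_on S f \<Longrightarrow> continuous_on S (\<lambda>x. gmap (f x))"
  unfolding gmap_def by (intro continuous_intros)

lemma Re_kmap: "Re (kmap \<zeta>) = Re \<zeta> + exp (- Re \<zeta>) * cos (Im \<zeta>)"
  by (simp add: kmap_def Re_exp)

lemma Im_kmap: "Im (kmap \<zeta>) = Im \<zeta> - exp (- Re \<zeta>) * sin (Im \<zeta>)"
  by (simp add: kmap_def Im_exp)

lemma open_kmap_image: "open S \<Longrightarrow> open (kmap ` S)"
proof (rule open_mapping_thm[of kmap UNIV])
  show "\<not> kmap constant_on UNIV"
  proof
    assume "kmap constant_on UNIV"
    then have "kmap 0 = kmap 1" unfolding constant_on_def by (metis UNIV_I)
    then have "Re (kmap 0) = Re (kmap 1)" by simp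
    then have "exp (-1 :: real) = 0" by (simp add: Re_kmap)
    then show False by simp
  qed
qed (auto intro: kmap_holomorphic)

lemma open_gmap_image: "open S \<Longrightarrow> open (gmap ` S)"
proof -
  assume "open S"
  then have "open ((\<lambda>w. 1 + w) ` kmap ` (\<lambda>w. (2::real) *\<^sub>R w) ` S)"
    by (intro open_translation open_kmap_image open_scaling) auto
  also have "(\<lambda>w. 1 + w) ` kmap ` (\<lambda>w. (2::real) *\<^sub>R w) ` S = gmap ` S"
    by (auto simp: gmap_def image_iff scaleR_conv_of_real)
  finally show ?thesis .
qed

text \<open>The critical points of the function are the integer multiples of \<open>2 \<pi> \<i>\<close>, with critical values of
real part 1, so superlevel sets of the real part below that level should be connected. Explicitly,
\<open>x + exp (- x) cos y\<close> increases with \<open>x\<close> where \<open>cos y \<le> 0\<close>; where \<open>cos y > 0\<close> it increases when \<open>y\<close>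
moves to the nearest multiple of \<open>2 \<pi>\<close>, and on that horizontal line it is at least 1 throughout.
Either way every point is joined inside the set to a right half-plane.\<close>

lemma connected_kmap_superlevel:
  assumes "c < 1"
  shows "connected {\<zeta>. c < Re (kmap \<zeta>)}" (is "connected ?S")
proof (rule connected_if_points_reach_connected_subset)
  let ?H = "{\<zeta>. 2 < Re \<zeta>}"
  show "connected ?H" by (intro convex_connected convex_halfspace_Re_gt)
  show "?H \<subseteq> ?S"
  proof
    fix \<zeta> assume "\<zeta> \<in> ?H"
    then have x: "2 < Re \<zeta>" by simp
    have "exp (- Re \<zeta>) * (-1) \<le> exp (- Re \<zeta>) * cos (Im \<zeta>)"
      by (intro mult_left_mono) auto
    moreover have "exp (- Re \<zeta>) \<le> 1" using x by simp
    ultimately show "\<zeta> \<in> ?S" using x assms unfolding Re_kmap mem_Collect_eq by linarith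
  qed
  \<comment> \<open>The horizontal rays on which the argument below travels to the right.\<close>
  let ?ray = "\<lambda>\<zeta>. (\<lambda>x. Complex x (Im \<zeta>)) ` {Re \<zeta>..}"
  have conn_ray: "connected (?ray \<zeta>)" for \<zeta>
    by (intro connected_continuous_image) (auto simp: Complex_eq intro!: continuous_intros)
  have mem_ray: "\<zeta> \<in> ?ray \<zeta>" for \<zeta> by (rule image_eqI[of _ _ "Re \<zeta>"]) auto
  have ray_H: "?ray \<zeta> \<inter> ?H \<noteq> {}" for \<zeta>
  proof -
    have "Complex (max 3 (Re \<zeta>)) (Im \<zeta>) \<in> ?ray \<zeta> \<inter> ?H" by auto
    then show ?thesis by blast
  qed
  fix \<zeta> assume \<zeta>: "\<zeta> \<in> ?S"
  show "\<exists>T. connected T \<and> T \<subseteq> ?S \<and> \<zeta> \<in> T \<and> T \<inter> ?H \<noteq> {}"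
  proof (cases "cos (Im \<zeta>) \<le> 0")
    case True
    have "?ray \<zeta> \<subseteq> ?S"
    proof (rule image_subsetI)
      fix x assume x: "x \<in> {Re \<zeta>..}"
      then have "exp (- Re \<zeta>) * cos (Im \<zeta>) \<le> exp (- x) * cos (Im \<zeta>)"
        by (intro mult_right_mono_neg True) auto
      then show "Complex x (Im \<zeta>) \<in> ?S" using \<zeta> x by (simp add: Re_kmap)
    qed
    then show ?thesis using conn_ray[of \<zeta>] mem_ray[of \<zeta>] ray_H[of \<zeta>]
      by (intro exI[of _ "?ray \<zeta>"] conjI)
  next
    case False
    obtain m :: int where m: "\<bar>Im \<zeta> - of_int m * (2 * pi)\<bar> \<le> pi"
    proof -
      have "\<bar>of_int (round (Im \<zeta> / (2 * pi))) - Im \<zeta> / (2 * pi)\<bar> \<le> 1 / 2"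
        by (rule of_int_round_abs_le)
      then have "\<bar>of_int (round (Im \<zeta> / (2 * pi))) - Im \<zeta> / (2 * pi)\<bar> * (2 * pi) \<le> 1 / 2 * (2 * pi)"
        by (intro mult_right_mono) auto
      moreover have "\<bar>of_int (round (Im \<zeta> / (2 * pi))) - Im \<zeta> / (2 * pi)\<bar> * (2 * pi)
          = \<bar>Im \<zeta> - of_int (round (Im \<zeta> / (2 * pi))) * (2 * pi)\<bar>"
        using abs_mult[of "of_int (round (Im \<zeta> / (2 * pi))) - Im \<zeta> / (2 * pi)" "2 * pi"]
        by (simp add: left_diff_distrib abs_minus_commute)
      ultimately show thesis by (intro that[of "round (Im \<zeta> / (2 * pi))"]) simp
    qed
    define y0 where "y0 = of_int m * (2 * pi)"
    have cos_y0: "cos (y + y0) = cos y" for y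
      using cos_int_2pin[of m] sin_int_2pin[of m] unfolding y0_def
      by (simp add: cos_add mult.commute)
    define \<zeta>0 where "\<zeta>0 = Complex (Re \<zeta>) y0"
    have seg: "closed_segment \<zeta> \<zeta>0 \<subseteq> ?S"
    proof
      fix \<xi> assume "\<xi> \<in> closed_segment \<zeta> \<zeta>0"
      then obtain u where u: "0 \<le> u" "u \<le> 1" "\<xi> = (1 - u) *\<^sub>R \<zeta> + u *\<^sub>R \<zeta>0"
        unfolding in_segment by blast
      have re: "Re \<xi> = Re \<zeta>" unfolding u(3) \<zeta>0_def by (simp add: algebra_simps)
      have im: "Im \<xi> - y0 = (1 - u) * (Im \<zeta> - y0)" unfolding u(3) \<zeta>0_def by (simp add: algebra_simps)
      have "\<bar>Im \<xi> - y0\<bar> \<le> 1 * \<bar>Im \<zeta> - y0\<bar>"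
        unfolding im abs_mult using u by (intro mult_right_mono) auto
      then have "cos \<bar>Im \<zeta> - y0\<bar> \<le> cos \<bar>Im \<xi> - y0\<bar>"
        using m by (intro cos_monotone_0_pi_le) (auto simp: y0_def)
      then have "cos (Im \<zeta>) \<le> cos (Im \<xi>)"
        using cos_y0[of "Im \<zeta> - y0"] cos_y0[of "Im \<xi> - y0"] by simp
      then have "exp (- Re \<zeta>) * cos (Im \<zeta>) \<le> exp (- Re \<zeta>) * cos (Im \<xi>)"
        by (intro mult_left_mono) auto
      then show "\<xi> \<in> ?S" using \<zeta> unfolding Re_kmap mem_Collect_eq re by linarith
    qed
    have ray: "?ray \<zeta>0 \<subseteq> ?S"
    proof (rule image_subsetI)
      fix x :: real
      have "1 + (- x) \<le> exp (- x)" by (rule exp_ge_add_one_self)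
      then show "Complex x (Im \<zeta>0) \<in> ?S"
        using assms cos_y0[of 0] by (simp add: Re_kmap \<zeta>0_def)
    qed
    have "connected (closed_segment \<zeta> \<zeta>0 \<union> ?ray \<zeta>0)"
      using mem_ray[of \<zeta>0] conn_ray[of \<zeta>0] by (intro connected_Un) auto
    then show ?thesis using seg ray ray_H[of \<zeta>0]
      by (intro exI[of _ "closed_segment \<zeta> \<zeta>0 \<union> ?ray \<zeta>0"]) auto
  qed
qed

lemma connected_gmap_superlevel:
  assumes "c < 2"
  shows "connected {w. c < Re (gmap w)}"
proof -
  have "connected ((\<lambda>\<zeta>. \<zeta> / 2) ` {\<zeta>. c - 1 < Re (kmap \<zeta>)})"
    using assms by (intro connected_continuous_image connected_kmap_superlevel continuous_intros) auto
  also have "(\<lambda>\<zeta>. \<zeta> / 2) ` {\<zeta>. c - 1 < Re (kmap \<zeta>)} = {w. c < Re (gmap w)}"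
    by (auto simp: gmap_def image_iff algebra_simps intro!: exI[of _ "2 * _"])
  finally show ?thesis .
qed

text \<open>The lines \<open>Im \<zeta> = \<pi> j\<close> are invariant. A connected set with bounded image avoids all these lines
with large \<open>j\<close>, so its imaginary part is bounded. In a horizontal strip the function tends to
infinity at both ends: like the identity on the right, like an exponential on the left.\<close>

lemma bounded_if_kmap_image_bounded:
  assumes S: "connected S" and b: "bounded (kmap ` S)"
  shows "bounded S"
proof -
  obtain R where R: "\<And>\<zeta>. \<zeta> \<in> S \<Longrightarrow> norm (kmap \<zeta>) \<le> R"
    using b unfolding bounded_iff by blast
  obtain m :: nat where m: "R < real m * pi"
    using reals_Archimedean3[of pi] by auto
  have conn_Im: "connected (Im ` S)"
    by (intro connected_continuous_image S continuous_intros)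
  have avoid: "of_int j * pi \<notin> Im ` S" if j: "R < \<bar>of_int j * pi\<bar>" for j :: int
  proof
    assume "of_int j * pi \<in> Im ` S"
    then obtain \<zeta> where \<zeta>: "\<zeta> \<in> S" "Im \<zeta> = of_int j * pi" by auto
    then have "Im (kmap \<zeta>) = of_int j * pi"
      by (simp add: Im_kmap sin_zero_iff_int2)
    then show False using R[OF \<zeta>(1)] abs_Im_le_cmod[of "kmap \<zeta>"] j by simp
  qed
  have "bounded (Im ` S)"
  proof (cases "S = {}")
    case False
    then obtain \<zeta>0 where \<zeta>0: "\<zeta>0 \<in> S" by blast
    obtain n :: nat where n: "m \<le> n" "\<bar>Im \<zeta>0\<bar> < real n * pi"
    proof -
      obtain n' :: nat where "\<bar>Im \<zeta>0\<bar> < real n' * pi"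
        using reals_Archimedean3[of pi] by auto
      moreover have "real n' * pi \<le> real (max m n') * pi" by (intro mult_right_mono) auto
      ultimately show ?thesis using that[of "max m n'"] by linarith
    qed
    have "real m * pi \<le> real n * pi" using n by (intro mult_right_mono) auto
    then have "R < real n * pi" using m by linarith
    then have no: "real n * pi \<notin> Im ` S" "- (real n * pi) \<notin> Im ` S"
      using avoid[of "int n"] avoid[of "- int n"] by auto
    have "\<bar>Im \<zeta>\<bar> \<le> real n * pi" if "\<zeta> \<in> S" for \<zeta>
    proof (rule ccontr)
      assume "\<not> \<bar>Im \<zeta>\<bar> \<le> real n * pi"
      then have "real n * pi \<in> Im ` S \<or> - (real n * pi) \<in> Im ` S"
        using connectedD_interval[OF conn_Im, of "Im \<zeta>0" "Im \<zeta>" "real n * pi"]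
          connectedD_interval[OF conn_Im, of "Im \<zeta>" "Im \<zeta>0" "- (real n * pi)"] n \<zeta>0 that by force
      then show False using no by blast
    qed
    then show ?thesis by (intro boundedI[of _ "real n * pi"]) auto
  qed simp
  then obtain B where B: "\<And>\<zeta>. \<zeta> \<in> S \<Longrightarrow> \<bar>Im \<zeta>\<bar> \<le> B" unfolding bounded_iff by auto
  have "norm \<zeta> \<le> R + 1 + 2 * R + 2 * B + B + 6" if \<zeta>: "\<zeta> \<in> S" for \<zeta>
  proof -
    have e: "norm (kmap \<zeta>) \<le> R" "norm \<zeta> \<le> \<bar>Re \<zeta>\<bar> + \<bar>Im \<zeta>\<bar>"
      using R \<zeta> cmod_le by auto
    have R0: "0 \<le> R" using e norm_ge_zero order_trans by blast
    have B0: "0 \<le> B" using B[OF \<zeta>] by simp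
    have n1: "norm (exp (- \<zeta>)) = exp (- Re \<zeta>)" by simp
    have t: "norm (kmap \<zeta> - exp (- \<zeta>)) = norm \<zeta>" by (simp add: kmap_def)
    show ?thesis
    proof (cases "Re \<zeta> \<ge> 0")
      case True
      then have "exp (- Re \<zeta>) \<le> 1" by simp
      then have "norm \<zeta> \<le> R + 1"
        using t n1 e norm_triangle_ineq4[of "kmap \<zeta>" "exp (- \<zeta>)"] by linarith
      then show ?thesis using R0 B0 by linarith
    next
      case False
      define x where "x = - Re \<zeta>"
      have x: "0 < x" using False by (simp add: x_def)
      have "exp x = norm (kmap \<zeta> - \<zeta>)" by (simp add: kmap_def x_def)
      also have "\<dots> \<le> norm (kmap \<zeta>) + norm \<zeta>" by (rule norm_triangle_ineq4)
      finally have "exp x \<le> norm (kmap \<zeta>) + norm \<zeta>" .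
      then have u: "exp x \<le> R + (x + B)"
        using e B[OF \<zeta>] x by (simp add: x_def)
      have l: "1 + x + x\<^sup>2 / 2 \<le> exp x"
        using exp_lower_Taylor_quadratic[of x] x by simp
      have "x\<^sup>2 / 2 \<le> R + B - 1" using u l by linarith
      then have "x\<^sup>2 \<le> 2 * (R + B)" by simp
      moreover have "2 * x \<le> 1 + x\<^sup>2"
        using sum_power2_ge_zero[of "x - 1" 0] by (simp add: power2_diff)
      ultimately have "2 * x \<le> 1 + 2 * (R + B)" by (rule order_trans[OF _ add_left_mono, rotated])
      then have "x \<le> 2 * R + 2 * B + 1" using R0 B0 by argo
      then show ?thesis using e B[OF \<zeta>] x R0 B0 by (simp add: x_def)
    qed
  qed
  then show ?thesis unfolding bounded_iff by blast
qed

lemma bounded_if_gmap_image_bounded: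
  assumes S: "connected S" and b: "bounded (gmap ` S)"
  shows "bounded S"
proof -
  have "kmap ` (\<lambda>w. 2 * w) ` S = (\<lambda>w. - 1 + w) ` gmap ` S"
    by (auto simp: gmap_def image_iff)
  then have "bounded (kmap ` (\<lambda>w. 2 * w) ` S)"
    using bounded_translation[OF b, of "- 1"] by simp
  moreover have "connected ((\<lambda>w. 2 * w) ` S)"
    by (rule connected_continuous_image[OF _ S]) (intro continuous_intros)
  ultimately have "bounded ((\<lambda>w. 2 * w) ` S)"
    by (rule bounded_if_kmap_image_bounded[rotated])
  then have "bounded ((\<lambda>w. w / 2) ` (\<lambda>w. 2 * w) ` S)"
    by (rule bounded_linear_image) (rule bounded_linear_divide)
  then show ?thesis by (simp add: image_image)
qed

lemma continuous_on_F_map: "continuous_on S F_map"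
proof -
  have eq: "F_map = (\<lambda>p. (kmap (fst p + snd p), gmap (snd p)))"
    by (auto simp: F_map_eq fun_eq_iff)
  show ?thesis unfolding eq by (intro continuous_intros)
qed

lemma continuous_on_F_map_funpow: "continuous_on S (F_map ^^ n)"
proof (induction n)
  case (Suc n)
  then show ?case using continuous_on_compose[OF Suc continuous_on_F_map] by (simp add: comp_def)
qed (simp add: id_def)

lemma open_F_map_image:
  assumes S: "open S"
  shows "open (F_map ` S)"
proof (subst open_subopen, intro ballI)
  fix v assume "v \<in> F_map ` S"
  then obtain z w where zw: "(z, w) \<in> S" "v = F_map (z, w)" by auto
  let ?T = "(\<lambda>(s, w). (s - w, w)) -` S"
  have "open ?T"
    using continuous_open_vimage[OF S] unfolding case_prod_beta
    by (intro continuous_open_vimage S continuous_intros)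
  moreover have "(z + w, w) \<in> ?T" using zw by simp
  ultimately obtain A B where AB: "open A" "open B" "(z + w, w) \<in> A \<times> B" "A \<times> B \<subseteq> ?T"
    by (rule open_prod_elim)
  have "kmap ` A \<times> gmap ` B \<subseteq> F_map ` S"
  proof clarify
    fix s w assume "s \<in> A" "w \<in> B"
    then have "(s - w, w) \<in> S" using AB(4) by auto
    then show "(kmap s, gmap w) \<in> F_map ` S" by (force simp: F_map_eq)
  qed
  moreover have "open (kmap ` A \<times> gmap ` B)" using AB open_kmap_image open_gmap_image by (intro open_Times)
  moreover have "v \<in> kmap ` A \<times> gmap ` B" using AB zw by (auto simp: F_map_eq)
  ultimately show "\<exists>T. open T \<and> v \<in> T \<and> T \<subseteq> F_map ` S" by blast
qed

lemma bounded_if_F_map_image_bounded: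
  assumes S: "connected S" and b: "bounded (F_map ` S)"
  shows "bounded S"
proof -
  have "gmap ` snd ` S = snd ` F_map ` S" "kmap ` (\<lambda>p. fst p + snd p) ` S = fst ` F_map ` S"
    by (force simp: F_map_eq image_iff)+
  then have "bounded (gmap ` snd ` S)" "bounded (kmap ` (\<lambda>p. fst p + snd p) ` S)"
    using bounded_snd[OF b] bounded_fst[OF b] by simp_all
  moreover have "connected (snd ` S)" "connected ((\<lambda>p. fst p + snd p) ` S)"
    by (rule connected_continuous_image[OF _ S], intro continuous_intros)+
  ultimately have w: "bounded (snd ` S)" and \<zeta>: "bounded ((\<lambda>p. fst p + snd p) ` S)"
    using bounded_if_gmap_image_bounded bounded_if_kmap_image_bounded by blast+
  have "bounded (fst ` S)"
    using bounded_minus_comp[OF \<zeta> w] by simp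
  then have "bounded (fst ` S \<times> snd ` S)" using w by (rule bounded_Times)
  then show ?thesis by (rule bounded_subset) (rule subset_fst_snd)
qed

section \<open>Orbits in a convex trap\<close>

text \<open>This quarter-space is convex, forward invariant and absorbed by \<open>L_dom\<close>. It is preferable to
\<open>L_dom\<close>, whose preimage is disconnected because the critical values \<open>1 + 2 \<pi> \<i> j\<close> of
\<open>kmap\<close> lie on the boundary of \<open>Re z > 1\<close>. With the bound \<open>- 1\<close> they are interior, and since
\<open>Q_dom\<close> is a product, so is its preimage in the coordinates \<open>(z + w, w)\<close>.\<close>

definition Q_dom :: "(complex \<times> complex) set" where
  "Q_dom = {(z, w). - 1 < Re z \<and> 1 < Re w}"

lemma open_Q_dom: "open Q_dom"
proof -
  have eq: "Q_dom = {z. -1 < Re z} \<times> {w. 1 < Re w}" by (auto simp: Q_dom_def)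
  show ?thesis unfolding eq by (intro open_Times open_halfspace_Re_gt)
qed

lemma connected_F_map_vimage_Q_dom: "connected (F_map -` Q_dom)"
proof -
  let ?A = "{\<zeta>. - 1 < Re (kmap \<zeta>)}" and ?B = "{w. 1 < Re (gmap w)}"
  let ?shear = "\<lambda>p :: complex \<times> complex. (fst p - snd p, snd p)"
  have "connected (?A \<times> ?B)"
    by (intro connected_Times connected_kmap_superlevel connected_gmap_superlevel) simp_all
  then have "connected (?shear ` (?A \<times> ?B))"
    by (intro connected_continuous_image continuous_intros)
  also have "?shear ` (?A \<times> ?B) = F_map -` Q_dom"
  proof (intro set_eqI iffI)
    fix p assume "p \<in> F_map -` Q_dom"
    then have "(fst p + snd p, snd p) \<in> ?A \<times> ?B"
      by (cases p) (simp add: F_map_eq Q_dom_def)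
    then show "p \<in> ?shear ` (?A \<times> ?B)" by (rule rev_image_eqI) simp
  qed (auto simp: F_map_eq Q_dom_def)
  finally show ?thesis .
qed

lemma exp_neg_le: "exp (- x) \<le> 1 / (1 + x)" if "0 \<le> x" for x :: real
proof -
  have "1 + x \<le> exp x" by (rule exp_ge_add_one_self)
  then have "1 / exp x \<le> 1 / (1 + x)" using that by (intro divide_left_mono) auto
  then show ?thesis by (simp add: exp_minus field_simps)
qed

lemma norm_kmap_diff: "norm (kmap \<zeta> - \<zeta>) = exp (- Re \<zeta>)"
  by (simp add: kmap_def)

lemma Re_kmap_diff: "\<bar>Re (kmap \<zeta>) - Re \<zeta>\<bar> \<le> exp (- Re \<zeta>)"
  using abs_Re_le_cmod[of "kmap \<zeta> - \<zeta>"] by (simp add: norm_kmap_diff)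

lemma Re_gmap_diff: "\<bar>Re (gmap w) - (2 * Re w + 1)\<bar> \<le> exp (- 2 * Re w)"
  using Re_kmap_diff[of "2 * w"] by (simp add: gmap_def)

lemma Re_gmap_ge: "0 \<le> Re w \<Longrightarrow> 2 * Re w \<le> Re (gmap w)"
proof -
  assume "0 \<le> Re w"
  then have "exp (- 2 * Re w) \<le> 1" by simp
  then show ?thesis using Re_gmap_diff[of w] by linarith
qed

lemma Q_dom_step:
  assumes "p \<in> Q_dom"
  shows "F_map p \<in> Q_dom"
    and "norm ((fst (F_map p) - snd (F_map p)) - (fst p - snd p)) \<le> 3"
proof -
  obtain z w where p: "p = (z, w)" by (cases p)
  have zw: "-1 < Re z" "1 < Re w" using assms by (auto simp: p Q_dom_def)
  have e: "exp (- Re (z + w)) \<le> 1" "exp (- Re (2 * w)) \<le> 1" using zw by auto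
  have "Re z + Re w - exp (- Re (z + w)) \<le> Re (kmap (z + w))"
    using Re_kmap_diff[of "z + w"] by simp
  then have "-1 < Re (kmap (z + w))" using e zw by linarith
  moreover have "1 < Re (gmap w)" using Re_gmap_ge[of w] zw by linarith
  ultimately show "F_map p \<in> Q_dom" by (simp add: p F_map_eq Q_dom_def)
  have "(kmap (z + w) - gmap w) - (z - w) = (kmap (z + w) - (z + w)) - (kmap (2 * w) - 2 * w) - 1"
    by (simp add: gmap_def)
  also have "norm \<dots> \<le> norm (kmap (z + w) - (z + w)) + norm (kmap (2 * w) - 2 * w) + norm (1 :: complex)"
    by (rule order_trans[OF norm_triangle_ineq4 add_right_mono[OF norm_triangle_ineq4]])
  also have "\<dots> \<le> 3" unfolding norm_kmap_diff norm_one using e by linarith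
  finally show "norm ((fst (F_map p) - snd (F_map p)) - (fst p - snd p)) \<le> 3"
    by (simp add: p F_map_eq)
qed

text \<open>The second coordinate doubles at each step while the difference of the coordinates
grows at most linearly, so their quotient tends to 1.\<close>

lemma Q_dom_orbit:
  assumes "p \<in> Q_dom"
  shows "(F_map ^^ n) p \<in> Q_dom"
    and "2 ^ n \<le> Re (snd ((F_map ^^ n) p))"
    and "norm (fst ((F_map ^^ n) p) - snd ((F_map ^^ n) p)) \<le> norm (fst p - snd p) + 3 * real n"
proof -
  have "(F_map ^^ n) p \<in> Q_dom \<and> 2 ^ n \<le> Re (snd ((F_map ^^ n) p)) \<and>
    norm (fst ((F_map ^^ n) p) - snd ((F_map ^^ n) p)) \<le> norm (fst p - snd p) + 3 * real n"
  proof (induction n)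
    case 0
    then show ?case using assms by (auto simp: Q_dom_def)
  next
    case (Suc n)
    define q where "q = (F_map ^^ n) p"
    have q: "q \<in> Q_dom" "2 ^ n \<le> Re (snd q)"
      "norm (fst q - snd q) \<le> norm (fst p - snd p) + 3 * real n"
      using Suc by (auto simp: q_def)
    have "snd (F_map q) = gmap (snd q)" by (cases q) (simp add: F_map_eq)
    moreover have "0 \<le> Re (snd q)" using q(1) by (auto simp: Q_dom_def)
    ultimately have "2 ^ Suc n \<le> Re (snd (F_map q))" using Re_gmap_ge[of "snd q"] q(2) by simp
    moreover have "norm (fst (F_map q) - snd (F_map q)) \<le> norm (fst q - snd q) + 3"
      using Q_dom_step(2)[OF q(1)] norm_triangle_sub[of "fst (F_map q) - snd (F_map q)" "fst q - snd q"]
      by linarith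
    ultimately show ?case using q Q_dom_step(1)[OF q(1)] by (simp add: q_def)
  qed
  then show "(F_map ^^ n) p \<in> Q_dom"
    and "2 ^ n \<le> Re (snd ((F_map ^^ n) p))"
    and "norm (fst ((F_map ^^ n) p) - snd ((F_map ^^ n) p)) \<le> norm (fst p - snd p) + 3 * real n"
    by auto
qed

lemma L_dom_iff: "(z, w) \<in> L_dom \<longleftrightarrow> Re z + 1 < Re w \<and> 1 < Re z"
proof
  assume "Re z + 1 < Re w \<and> 1 < Re z"
  then have "1 < (Re w - Re z + 1) / 2" "Re z + (Re w - Re z + 1) / 2 < Re w" "1 < Re z" "1 < Re w"
    by (auto simp: field_simps)
  then show "(z, w) \<in> L_dom"
    unfolding L_dom_def L_alpha_def by (intro UN_I[of "(Re w - Re z + 1) / 2"]) auto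
qed (auto simp: L_dom_def L_alpha_def)

lemma L_dom_subset_Q_dom: "L_dom \<subseteq> Q_dom"
  by (auto simp: L_dom_iff Q_dom_def)

text \<open>From the first iterate on, both exponential terms are so small that \<open>Re w - Re z\<close> grows
by at least \<open>1 / 4\<close> per step: the constant 1 in the second coordinate wins.\<close>

lemma Q_dom_absorbed:
  assumes "p \<in> Q_dom"
  shows "\<exists>n. (F_map ^^ n) p \<in> L_dom"
proof -
  define z w where "z = (\<lambda>n. fst ((F_map ^^ n) p))" and "w = (\<lambda>n. snd ((F_map ^^ n) p))"
  have zw: "-1 < Re (z n)" "2 ^ n \<le> Re (w n)" for n
    using Q_dom_orbit[OF assms, of n] by (auto simp: z_def w_def Q_dom_def)
  have step: "z (Suc n) = kmap (z n + w n)" "w (Suc n) = gmap (w n)" for n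
    by (cases "(F_map ^^ n) p"; simp add: z_def w_def F_map_eq)+
  have pow: "1 \<le> (2 :: real) ^ n" for n by simp
  have w2: "2 \<le> Re (w (Suc n))" for n
    using zw(2)[of "Suc n"] pow[of n] unfolding power_Suc by linarith
  have gap: "4 * (Re (w 1) - Re (z 1)) + real n \<le> 4 * (Re (w (Suc n)) - Re (z (Suc n)))" for n
  proof (induction n)
    case (Suc n)
    have "1 \<le> Re (z (Suc n) + w (Suc n))" using zw(1)[of "Suc n"] w2[of n] by simp
    then have "exp (- Re (z (Suc n) + w (Suc n))) \<le> exp (- 1)" by simp
    also have "\<dots> \<le> (1 :: real) / 2" using exp_neg_le[of 1] by simp
    finally have "Re (z (Suc (Suc n))) \<le> Re (z (Suc n)) + Re (w (Suc n)) + 1 / 2"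
      using Re_kmap_diff[of "z (Suc n) + w (Suc n)"] unfolding step(1)[of "Suc n"] by simp
    moreover have "exp (- 2 * Re (w (Suc n))) \<le> exp (- 4)" using w2[of n] by simp
    then have "exp (- 2 * Re (w (Suc n))) \<le> 1 / 5"
      by (rule order_trans) (use exp_neg_le[of 4] in simp)
    then have "2 * Re (w (Suc n)) + 4 / 5 \<le> Re (w (Suc (Suc n)))"
      using Re_gmap_diff[of "w (Suc n)"] unfolding step(2)[of "Suc n"] by linarith
    ultimately show ?case using Suc by simp
  qed simp
  have big: "1 < Re (z (Suc (Suc (Suc n))))" for n
  proof -
    have "4 \<le> Re (w (Suc (Suc n)))"
      using zw(2)[of "Suc (Suc n)"] pow[of n] unfolding power_Suc by linarith
    then have "3 < Re (z (Suc (Suc n)) + w (Suc (Suc n)))" using zw(1)[of "Suc (Suc n)"] by simp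
    moreover from this have "exp (- Re (z (Suc (Suc n)) + w (Suc (Suc n)))) \<le> 1" by simp
    ultimately show ?thesis
      using Re_kmap_diff[of "z (Suc (Suc n)) + w (Suc (Suc n))"] unfolding step(1)[of "Suc (Suc n)"]
      by linarith
  qed
  obtain n :: nat where "4 * (1 - (Re (w 1) - Re (z 1))) < real n" using reals_Archimedean2 by blast
  then have "4 * (1 - (Re (w 1) - Re (z 1))) < real (Suc (Suc n))" by simp
  then have "(z (Suc (Suc (Suc n))), w (Suc (Suc (Suc n)))) \<in> L_dom"
    using big[of n] gap[of "Suc (Suc n)"] unfolding L_dom_iff by argo
  then have "(F_map ^^ Suc (Suc (Suc n))) p \<in> L_dom"
    unfolding z_def w_def prod.collapse .
  then show ?thesis ..
qed

section \<open>The basin of the absorbing domain\<close>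

definition basin :: "(complex \<times> complex) set" where
  "basin = (\<Union>n. (F_map ^^ n) -` L_dom)"

lemma vimage_Q_dom_mono: "m \<le> n \<Longrightarrow> (F_map ^^ m) -` Q_dom \<subseteq> (F_map ^^ n) -` Q_dom"
  using Q_dom_orbit(1)[of "(F_map ^^ m) _" "n - m"]
  by (auto simp flip: funpow_add[THEN fun_cong, unfolded comp_def])

lemma basin_eq: "basin = (\<Union>n. (F_map ^^ n) -` Q_dom)"
proof
  show "(\<Union>n. (F_map ^^ n) -` Q_dom) \<subseteq> basin"
  proof
    fix p assume "p \<in> (\<Union>n. (F_map ^^ n) -` Q_dom)"
    then obtain n where "(F_map ^^ n) p \<in> Q_dom" by auto
    then obtain m where "(F_map ^^ m) ((F_map ^^ n) p) \<in> L_dom" using Q_dom_absorbed by blast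
    then have "(F_map ^^ (m + n)) p \<in> L_dom" by (simp add: funpow_add)
    then show "p \<in> basin" unfolding basin_def by blast
  qed
qed (use L_dom_subset_Q_dom in \<open>auto simp: basin_def\<close>)

lemma open_vimage_Q_dom: "open ((F_map ^^ n) -` Q_dom)"
  using continuous_on_open_vimage[of UNIV "F_map ^^ n"] continuous_on_F_map_funpow open_Q_dom by auto

lemma connected_funpow_vimage_Q_dom: "connected ((F_map ^^ n) -` Q_dom)"
proof (induction n)
  case 0
  have "convex Q_dom"
  proof -
    have eq: "Q_dom = {z. -1 < Re z} \<times> {w. 1 < Re w}" by (auto simp: Q_dom_def)
    show ?thesis unfolding eq by (intro convex_Times convex_halfspace_Re_gt)
  qed
  then show ?case by (simp add: convex_connected)
next
  case (Suc n)
  have "connected (F_map -` ((F_map ^^ n) -` Q_dom))"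
  proof (rule connected_vimage_if_connected_subvimage[OF continuous_on_F_map _ _ open_vimage_Q_dom Suc
        connected_F_map_vimage_Q_dom])
    have "(0, 2) \<in> Q_dom" by (simp add: Q_dom_def)
    then show "Q_dom \<noteq> {}" by blast
    show "Q_dom \<subseteq> (F_map ^^ n) -` Q_dom" using vimage_Q_dom_mono[of 0 n] by simp
  qed (fact open_F_map_image bounded_if_F_map_image_bounded)+
  moreover have "F_map -` ((F_map ^^ n) -` Q_dom) = (F_map ^^ Suc n) -` Q_dom"
    by (simp only: funpow_Suc_right vimage_comp)
  ultimately show ?case by (simp only:)
qed

lemma connected_basin: "connected basin"
  unfolding basin_eq
proof (rule connected_Union)
  fix A assume "A \<in> range (\<lambda>n. (F_map ^^ n) -` Q_dom)"
  then show "connected A" using connected_funpow_vimage_Q_dom by auto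
next
  have "(0, 2) \<in> Q_dom" by (simp add: Q_dom_def)
  then have "(0, 2) \<in> \<Inter> (range (\<lambda>n. (F_map ^^ n) -` Q_dom))"
    using vimage_Q_dom_mono[of 0] by (intro INT_I) (auto dest: subsetD)
  then show "\<Inter> (range (\<lambda>n. (F_map ^^ n) -` Q_dom)) \<noteq> {}" by blast
qed

section \<open>Convergence to a point at infinity\<close>

definition pt_inf :: proj_plane where
  "pt_inf = abs_proj_plane (vector [1, 1, 0])"

lemma embed_eq: "embed (z, w) = abs_proj_plane (vector [z, w, 1])"
  by (simp add: embed.abs_eq)

lemma continuous_on_vector3:
  fixes f g h :: "'a::topological_space \<Rightarrow> complex"
  assumes "continuous_on S f" "continuous_on S g" "continuous_on S h"
  shows "continuous_on S (\<lambda>x. vector [f x, g x, h x] :: complex^3)"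
proof (rule continuous_on_vec_lambda[of S "\<lambda>i x. (vector [f x, g x, h x] :: complex^3) $ i", simplified])
  fix i :: 3
  show "continuous_on S (\<lambda>x. (vector [f x, g x, h x] :: complex^3) $ i)"
    using exhaust_3[of i] assms by (auto simp: vector_3)
qed

lemma embed_near_pt_inf:
  assumes "\<epsilon> > 0"
  obtains \<delta> where "\<delta> > 0"
    "\<And>z w. w \<noteq> 0 \<Longrightarrow> norm (z / w - 1) < \<delta> \<Longrightarrow> norm (1 / w) < \<delta> \<Longrightarrow> dist (embed (z, w)) pt_inf < \<epsilon>"
proof -
  let ?h = "\<lambda>(a, b). abs_proj_plane (vector [a, 1, b])"
  have nz: "(vector [a, 1, b] :: complex^3) \<noteq> 0" for a b
    by (auto simp: vec_eq_iff forall_3 vector_3)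
  have "continuous_on UNIV ?h"
    unfolding case_prod_beta
    by (rule continuous_on_compose2[OF continuous_on_abs_proj_plane])
       (use nz in \<open>auto intro!: continuous_on_vector3 continuous_intros\<close>)
  then have "\<exists>d>0. \<forall>x. dist x (1, 0) < d \<longrightarrow> dist (?h x) (?h (1, 0)) < \<epsilon>"
    using assms unfolding continuous_on_iff by blast
  then obtain d where d: "d > 0" "\<And>x. dist x (1, 0) < d \<Longrightarrow> dist (?h x) (?h (1, 0)) < \<epsilon>" by blast
  show ?thesis
  proof (rule that[of "d / 2"])
    show "d / 2 > 0" using d by simp
    fix z w :: complex assume *: "w \<noteq> 0" "norm (z / w - 1) < d / 2" "norm (1 / w) < d / 2"
    have "dist (z / w, 1 / w) (1, 0) \<le> norm (z / w - 1) + norm (1 / w)"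
      using sqrt_sum_squares_le_sum[of "norm (z / w - 1)" "norm (1 / w)"]
      unfolding dist_Pair_Pair by (simp add: dist_norm)
    also have "\<dots> < d" using * by simp
    finally have "dist (?h (z / w, 1 / w)) (?h (1, 0)) < \<epsilon>" by (rule d(2))
    then have "dist (?h (z / w, 1 / w)) pt_inf < \<epsilon>" by (simp add: pt_inf_def)
    moreover have "vector [z, w, 1] = w *s (vector [z / w, 1, 1 / w] :: complex^3)"
      using * by (auto simp: vec_eq_iff forall_3 vector_3)
    then have "embed (z, w) = ?h (z / w, 1 / w)"
      unfolding embed_eq using abs_proj_plane_scale[OF nz, of w "z / w" "1 / w"] *
      by (simp add: vector_mul_eq_0 nz)
    ultimately show "dist (embed (z, w)) pt_inf < \<epsilon>" by simp
  qed
qed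

lemma basin_uniform_limit:
  assumes K: "compact K" "K \<subseteq> basin"
  shows "uniform_limit K (\<lambda>n. embed \<circ> F_map ^^ n) (\<lambda>_. pt_inf) sequentially"
proof (rule uniform_limitI)
  fix \<epsilon> :: real assume "\<epsilon> > 0"
  then obtain \<delta> where \<delta>: "\<delta> > 0"
    "\<And>z w. w \<noteq> 0 \<Longrightarrow> norm (z / w - 1) < \<delta> \<Longrightarrow> norm (1 / w) < \<delta> \<Longrightarrow> dist (embed (z, w)) pt_inf < \<epsilon>"
    by (rule embed_near_pt_inf) blast
  obtain X where X: "finite X" "K \<subseteq> (\<Union>n\<in>X. (F_map ^^ n) -` Q_dom)"
    using compactE_image[OF K(1), of UNIV "\<lambda>n. (F_map ^^ n) -` Q_dom"] open_vimage_Q_dom K(2)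
    unfolding basin_eq by metis
  define N where "N = Max (insert 0 X)"
  have N: "(F_map ^^ N) p \<in> Q_dom" if "p \<in> K" for p
  proof -
    obtain n where "n \<in> X" "p \<in> (F_map ^^ n) -` Q_dom" using subsetD[OF X(2) \<open>p \<in> K\<close>] by (rule UN_E)
    moreover from this have "n \<le> N" using X(1) by (simp add: N_def)
    ultimately show ?thesis using vimage_Q_dom_mono[of n N] by blast
  qed
  have "bounded ((\<lambda>p. fst ((F_map ^^ N) p) - snd ((F_map ^^ N) p)) ` K)"
    by (intro compact_imp_bounded compact_continuous_image K continuous_intros continuous_on_F_map_funpow)
  then obtain M where M: "\<And>p. p \<in> K \<Longrightarrow> norm (fst ((F_map ^^ N) p) - snd ((F_map ^^ N) p)) \<le> M"
    unfolding bounded_iff by auto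
  have "(\<lambda>n. (M + 3 * real n) / 2 ^ n) \<longlonglongrightarrow> 0" "(\<lambda>n. 1 / 2 ^ n :: real) \<longlonglongrightarrow> 0"
    by real_asymp+
  then have "\<forall>\<^sub>F n in sequentially. (M + 3 * real n) / 2 ^ n < \<delta>" "\<forall>\<^sub>F n in sequentially. 1 / 2 ^ n < \<delta>"
    using \<delta>(1) by (auto intro: order_tendstoD)
  then have "\<forall>\<^sub>F n in sequentially. \<forall>p\<in>K. dist (embed ((F_map ^^ (n + N)) p)) pt_inf < \<epsilon>"
  proof eventually_elim
    case (elim n)
    show ?case
    proof
      fix p assume p: "p \<in> K"
      obtain z w where zw: "(F_map ^^ (n + N)) p = (z, w)" by (cases "(F_map ^^ (n + N)) p")
      then have zw': "(F_map ^^ n) ((F_map ^^ N) p) = (z, w)" by (simp add: funpow_add)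
      have w: "2 ^ n \<le> Re w" "norm (z - w) \<le> M + 3 * real n"
        using Q_dom_orbit(2,3)[OF N[OF p], of n] M[OF p] unfolding zw' by auto
      then have w': "2 ^ n \<le> norm w" using complex_Re_le_cmod[of w] by linarith
      moreover have "0 < (2 :: real) ^ n" by simp
      ultimately have w0: "w \<noteq> 0" by force
      have "norm (1 / w) \<le> 1 / 2 ^ n"
        unfolding norm_divide norm_one using w' w0 by (intro divide_left_mono) auto
      moreover have "norm (z / w - 1) = norm (z - w) / norm w"
        using w0 by (simp add: diff_divide_distrib flip: norm_divide)
      moreover have "\<dots> \<le> (M + 3 * real n) / 2 ^ n"
        using w w' by (intro frac_le) (auto intro: order_trans[OF norm_ge_zero])
      ultimately show "dist (embed ((F_map ^^ (n + N)) p)) pt_inf < \<epsilon>"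
        unfolding zw using elim w0 by (intro \<delta>(2)) linarith+
    qed
  qed
  then show "\<forall>\<^sub>F n in sequentially. \<forall>p\<in>K. dist ((embed \<circ> F_map ^^ n) p) pt_inf < \<epsilon>"
    unfolding comp_def by (rule eventually_sequentially_seg[THEN iffD1])
qed

text \<open>A sequence of iterates either repeats one iterate infinitely often or has
exponents tending to infinity; the latter case is uniform convergence to the point at infinity.\<close>

lemma normal_on_basin: "normal_on basin (iterates F_map)"
  unfolding normal_on_def
proof (intro allI impI)
  fix f :: "nat \<Rightarrow> complex \<times> complex \<Rightarrow> proj_plane"
  assume "range f \<subseteq> iterates F_map"
  then have "\<forall>j. \<exists>n. f j = embed \<circ> F_map ^^ n" unfolding iterates_def by blast
  then obtain m where m: "\<And>j. f j = embed \<circ> F_map ^^ m j" by metis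
  show "\<exists>r :: nat \<Rightarrow> nat. strict_mono r \<and> (\<exists>g. \<forall>K. compact K \<and> K \<subseteq> basin \<longrightarrow>
    uniform_limit K (\<lambda>n. f (r n)) g sequentially)"
  proof (cases "\<exists>v. infinite {j. m j = v}")
    case True
    then obtain v where v: "infinite {j. m j = v}" by blast
    obtain r :: "nat \<Rightarrow> nat" where r: "strict_mono r" "\<And>n. r n \<in> {j. m j = v}"
      using infinite_enumerate[OF v] by blast
    then have "f (r n) = embed \<circ> F_map ^^ v" for n by (simp add: m)
    then have "uniform_limit K (\<lambda>n. f (r n)) (embed \<circ> F_map ^^ v) sequentially" for K
      by (simp add: uniform_limit_const)
    then show ?thesis using r by blast
  next
    case False
    have "filterlim m at_top sequentially"
      unfolding filterlim_at_top
    proof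
      fix b
      have "{j. m j < b} = (\<Union>v<b. {j. m j = v})" by auto
      then have "finite {j. m j < b}" using False by simp
      then show "\<forall>\<^sub>F j in sequentially. b \<le> m j"
        unfolding cofinite_eq_sequentially[symmetric] eventually_cofinite by (simp add: not_le)
    qed
    then have "uniform_limit K (\<lambda>n. f (id n)) (\<lambda>_. pt_inf) sequentially"
      if "compact K" "K \<subseteq> basin" for K
      using filterlim_compose[OF basin_uniform_limit[OF that]] by (simp add: m)
    then show ?thesis using strict_mono_id by blast
  qed
qed

lemma basin_subset_component:
  assumes U: "fatou_component F_map U" and L: "L_dom \<subseteq> U"
  shows "basin \<subseteq> U"
proof (rule components_maximal)
  show "U \<in> components (fatou_set F_map)" using U by (simp add: fatou_component_def)
  have "open basin" unfolding basin_eq using open_vimage_Q_dom by blast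
  then show "basin \<subseteq> fatou_set F_map" using normal_on_basin by (rule fatou_set_greatest)
  have "(2, 4) \<in> L_dom" by (simp add: L_dom_iff)
  moreover have "L_dom \<subseteq> basin" unfolding basin_def using UN_upper[of 0 UNIV "\<lambda>n. (F_map ^^ n) -` L_dom"] by simp
  ultimately show "U \<inter> basin \<noteq> {}" using L by blast
qed (rule connected_basin)

section \<open>Limits on the whole component\<close>

text \<open>The affine coordinates \<open>z / w\<close> and \<open>1 / w\<close> near \<open>[1 : 1 : 0]\<close>, read off from the second column of
the orthogonal projection that represents a point of the projective plane.\<close>

definition chart_x :: "proj_plane \<Rightarrow> complex" where
  "chart_x p = pmat p $ 1 $ 2 / pmat p $ 2 $ 2"

definition chart_y :: "proj_plane \<Rightarrow> complex" where
  "chart_y p = pmat p $ 3 $ 2 / pmat p $ 2 $ 2"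

lemma vector3_nonzero: "(vector [z, w, 1] :: complex^3) \<noteq> 0"
  by (auto simp: vec_eq_iff forall_3 vector_3)

lemma pmat_embed: "pmat (embed (z, w)) = line_proj (vector [z, w, 1])"
  unfolding embed_eq by (rule pmat_abs[OF vector3_nonzero])

lemma pmat_embed_22_eq_0_iff: "pmat (embed (z, w)) $ 2 $ 2 = 0 \<longleftrightarrow> w = 0"
  using vector3_nonzero[of z w] by (simp add: pmat_embed line_proj_def vector_3)

lemma chart_embed: "chart_x (embed (z, w)) = z / w" "chart_y (embed (z, w)) = 1 / w"
  using vector3_nonzero[of z w]
  by (auto simp: chart_x_def chart_y_def pmat_embed line_proj_def vector_3)

lemma pt_inf_nonzero: "(vector [1, 1, 0] :: complex^3) \<noteq> 0"
  by (auto simp: vec_eq_iff forall_3 vector_3)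

lemma pmat_pt_inf_22: "pmat pt_inf $ 2 $ 2 = 1 / 2"
proof -
  have "complex_of_real ((norm (vector [1, 1, 0] :: complex^3))\<^sup>2) = 2"
    unfolding norm_sq_vec by (simp add: sum_3 vector_3)
  then show ?thesis
    unfolding pt_inf_def pmat_abs[OF pt_inf_nonzero]
    by (simp add: line_proj_def vector_3 del: of_real_power)
qed

lemma chart_pt_inf: "chart_x pt_inf = 1" "chart_y pt_inf = 0"
  using pt_inf_nonzero unfolding chart_x_def chart_y_def pt_inf_def pmat_abs[OF pt_inf_nonzero]
  by (simp_all add: line_proj_def vector_3)

lemma pt_inf_if_chart:
  assumes "pmat p $ 2 $ 2 \<noteq> 0" "chart_x p = 1" "chart_y p = 0"
  shows "p = pt_inf"
proof -
  obtain u where u: "u \<noteq> 0" "p = abs_proj_plane u" by (rule abs_proj_plane_cases)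
  have pm: "pmat p $ i $ j = u $ i * cnj (u $ j) / of_real ((norm u)\<^sup>2)" for i j
    by (simp add: u pmat_abs line_proj_def)
  have u2: "u $ 2 \<noteq> 0" using assms(1) by (auto simp: pm)
  then have "u $ 1 = u $ 2" "u $ 3 = 0"
    using assms(2,3) u(1) by (simp_all add: chart_x_def chart_y_def pm)
  then have "u = u $ 2 *s vector [1, 1, 0]"
    by (simp add: vec_eq_iff forall_3 vector_3)
  then show ?thesis
    using abs_proj_plane_scale[OF pt_inf_nonzero, of "u $ 2"] u by (metis pt_inf_def)
qed

lemma continuous_on_pmat_entry: "continuous_on S (\<lambda>p. pmat p $ i $ j)"
proof -
  have "continuous_on S pmat"
    by (auto simp: continuous_on_iff dist_proj_plane_def)
  then show ?thesis by (intro continuous_intros)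
qed

lemma chart_near_pt_inf:
  assumes "\<epsilon> > 0"
  obtains \<eta> where "\<eta> > 0" "\<And>p. dist p pt_inf < \<eta> \<Longrightarrow> norm (pmat p $ 2 $ 2) > 1 / 4"
    "\<And>p. dist p pt_inf < \<eta> \<Longrightarrow> norm (chart_x p - 1) < \<epsilon>"
    "\<And>p. dist p pt_inf < \<eta> \<Longrightarrow> norm (chart_y p) < \<epsilon>"
proof -
  have t: "((\<lambda>p. pmat p $ i $ j) \<longlongrightarrow> pmat pt_inf $ i $ j) (nhds pt_inf)" for i j
    using continuous_on_pmat_entry[of UNIV i j]
    by (simp add: continuous_on_eq_continuous_at isCont_def tendsto_nhds_iff)
  have cx: "(chart_x \<longlongrightarrow> 1) (nhds pt_inf)" and cy: "(chart_y \<longlongrightarrow> 0) (nhds pt_inf)"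
    unfolding chart_pt_inf[symmetric] unfolding chart_x_def chart_y_def
    by (intro tendsto_divide t; simp add: pmat_pt_inf_22)+
  note tendsto_norm[OF tendsto_diff[OF cx tendsto_const[of 1]]] tendsto_norm[OF cy]
  moreover have "((\<lambda>p. norm (pmat p $ 2 $ 2)) \<longlongrightarrow> norm (pmat pt_inf $ 2 $ 2)) (nhds pt_inf)"
    by (intro tendsto_intros t)
  ultimately have "\<forall>\<^sub>F p in nhds pt_inf. norm (pmat p $ 2 $ 2) > 1 / 4 \<and>
      norm (chart_x p - 1) < \<epsilon> \<and> norm (chart_y p) < \<epsilon>"
    using assms by (intro eventually_conj order_tendstoD) (auto simp: pmat_pt_inf_22 norm_divide)
  then show ?thesis using that unfolding eventually_nhds_metric by blast
qed

lemma holomorphic_on_F_map_funpow: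
  assumes "u holomorphic_on S" "v holomorphic_on S"
  shows "(\<lambda>t. fst ((F_map ^^ n) (u t, v t))) holomorphic_on S"
    and "(\<lambda>t. snd ((F_map ^^ n) (u t, v t))) holomorphic_on S"
proof -
  have "(\<lambda>t. fst ((F_map ^^ n) (u t, v t))) holomorphic_on S \<and>
    (\<lambda>t. snd ((F_map ^^ n) (u t, v t))) holomorphic_on S"
  proof (induction n)
    case (Suc n)
    have "fst (F_map p) = exp (- (fst p + snd p)) + fst p + snd p"
      "snd (F_map p) = exp (- 2 * snd p) + 2 * snd p + 1" for p
      by (simp_all add: F_map_def case_prod_beta)
    then show ?case using Suc by (auto intro!: holomorphic_intros)
  qed (use assms in simp)
  then show "(\<lambda>t. fst ((F_map ^^ n) (u t, v t))) holomorphic_on S"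
    and "(\<lambda>t. snd ((F_map ^^ n) (u t, v t))) holomorphic_on S" by auto
qed

lemma continuous_on_embed: "continuous_on S embed"
proof -
  have eq: "embed = (\<lambda>p. abs_proj_plane (vector [fst p, snd p, 1]))"
    by (auto simp: fun_eq_iff embed_eq)
  show ?thesis unfolding eq
    by (rule continuous_on_compose2[OF continuous_on_abs_proj_plane])
       (use vector3_nonzero in \<open>auto intro!: continuous_on_vector3 continuous_intros\<close>)
qed

lemma uniform_limit_pmat_entry:
  assumes "uniform_limit K f g F"
  shows "uniform_limit K (\<lambda>n x. pmat (f n x) $ i $ j) (\<lambda>x. pmat (g x) $ i $ j) F"
proof (rule uniform_limitI)
  fix e :: real assume "e > 0"
  then have "\<forall>\<^sub>F n in F. \<forall>x\<in>K. dist (f n x) (g x) < e" using assms by (rule uniform_limitD[rotated])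
  moreover have "dist (pmat p $ i $ j) (pmat q $ i $ j) \<le> dist p q" for p q
    unfolding dist_proj_plane_def by (rule order_trans[OF dist_vec_nth_le dist_vec_nth_le])
  ultimately show "\<forall>\<^sub>F n in F. \<forall>x\<in>K. dist (pmat (f n x) $ i $ j) (pmat (g x) $ i $ j) < e"
    by (auto elim!: eventually_mono intro: le_less_trans)
qed

lemma uniform_limit_chart:
  assumes lim: "uniform_limit K f g F" and cont: "continuous_on K g" and K: "compact K"
    and away: "\<And>x. x \<in> K \<Longrightarrow> norm (pmat (g x) $ 2 $ 2) \<ge> 1 / 4"
  shows "uniform_limit K (\<lambda>n x. chart_x (f n x)) (\<lambda>x. chart_x (g x)) F"
    and "uniform_limit K (\<lambda>n x. chart_y (f n x)) (\<lambda>x. chart_y (g x)) F"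
proof -
  have "bounded ((\<lambda>x. pmat (g x) $ i $ j) ` K)" for i j
    by (intro compact_imp_bounded compact_continuous_image K)
       (rule continuous_on_compose2[OF continuous_on_pmat_entry cont subset_UNIV])
  then show "uniform_limit K (\<lambda>n x. chart_x (f n x)) (\<lambda>x. chart_x (g x)) F"
    and "uniform_limit K (\<lambda>n x. chart_y (f n x)) (\<lambda>x. chart_y (g x)) F"
    unfolding chart_x_def chart_y_def
    by (auto intro!: uniform_lim_divide[where b = "1 / 4"] uniform_limit_pmat_entry lim away)
qed

text \<open>The identity theorem for limit maps. Near a boundary point of the set where the limit is
\<open>pt_inf\<close>, late iterates stay in the chart around \<open>pt_inf\<close>, so there the
chart coordinates of the limit are uniform limits of holomorphic functions. Along the complex line
through a point of the open set and any nearby point, the one-variable identity theorem applies.\<close>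

lemma limit_constant_if_locally_constant:
  assumes U: "open U" "connected U" and V: "open V" "V \<noteq> {}" "V \<subseteq> U"
    and lim: "\<And>K. compact K \<Longrightarrow> K \<subseteq> U \<Longrightarrow> uniform_limit K (\<lambda>k. embed \<circ> F_map ^^ m k) f sequentially"
    and fV: "\<And>p. p \<in> V \<Longrightarrow> f p = pt_inf"
    and "p \<in> U"
  shows "f p = pt_inf"
proof -
  define W where "W = interior {p \<in> U. f p = pt_inf}"
  have W: "open W" "W \<subseteq> U" "\<And>p. p \<in> W \<Longrightarrow> f p = pt_inf"
    using interior_subset by (auto simp: W_def)
  have "V \<subseteq> W" unfolding W_def using V fV by (intro interior_maximal) auto
  have "closedin (top_of_set U) W"
    unfolding closedin_limpt
  proof (intro conjI allI impI W(2))
    fix p assume p: "p islimpt W \<and> p \<in> U"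
    obtain \<eta> where \<eta>: "\<eta> > 0" "\<And>p. dist p pt_inf < \<eta> \<Longrightarrow> norm (pmat p $ 2 $ 2) > 1 / 4"
      using chart_near_pt_inf[OF zero_less_one] by metis
    obtain R where R: "R > 0" "cball p R \<subseteq> U"
      using U(1) p open_contains_cball by blast
    have "continuous_on (cball p R) f"
      by (rule uniform_limit_theorem[OF always_eventually lim[OF compact_cball R(2)]])
         (intro allI continuous_on_compose continuous_on_embed continuous_on_F_map_funpow
           trivial_limit_sequentially)+
    note contf = this
    have "\<exists>d>0. \<forall>q\<in>cball p R. dist q p < d \<longrightarrow> dist (f q) (f p) < \<eta> / 4"
      using contf[unfolded continuous_on_iff, rule_format, of p "\<eta> / 4"] \<eta>(1) R(1) by simp
    then obtain d where d: "d > 0" "\<And>q. q \<in> cball p R \<Longrightarrow> dist q p < d \<Longrightarrow> dist (f q) (f p) < \<eta> / 4"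
      by blast
    define r where "r = min R (d / 2)"
    have r: "r > 0" "cball p r \<subseteq> U" using R d by (auto simp: r_def)
    have fr: "dist (f q) (f p) < \<eta> / 4" if "q \<in> cball p r" for q
      using that d(1) by (intro d(2)) (auto simp: r_def dist_commute)
    obtain a where a: "a \<in> W" "a \<in> ball p r"
      using p r(1) by (auto simp: islimpt_approachable dist_commute)
    have near: "dist (f q) pt_inf < \<eta> / 2" if "q \<in> cball p r" for q
      using fr[OF that] fr[of a] a W(3)[of a] dist_triangle2[of "f q" pt_inf "f p"] by simp
    have lim_r: "uniform_limit (cball p r) (\<lambda>k. embed \<circ> F_map ^^ m k) f sequentially"
      by (rule lim) (use r in auto)
    obtain k0 where k0: "\<And>k q. k \<ge> k0 \<Longrightarrow> q \<in> cball p r \<Longrightarrow>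
        dist (embed ((F_map ^^ m k) q)) (f q) < \<eta> / 2"
      using uniform_limitD[OF lim_r, of "\<eta> / 2"] \<eta>(1)
      unfolding eventually_sequentially comp_apply by (meson half_gt_zero)
    \<comment> \<open>Dropping the first \<open>k0\<close> maps keeps all the remaining ones in the domain of the chart.\<close>
    define G where "G = (\<lambda>k q. embed ((F_map ^^ m (k + k0)) q))"
    have limG: "uniform_limit (cball p r) G f sequentially"
      using filterlim_compose[OF lim_r filterlim_add_const_nat_at_top[of k0]]
      by (simp add: G_def comp_def)
    have nz: "snd ((F_map ^^ m (k + k0)) q) \<noteq> 0" if "q \<in> cball p r" for k q
    proof -
      have "dist (G k q) pt_inf < \<eta>"
        using k0[of "k + k0", OF _ that] near[OF that] dist_triangle[of "G k q" pt_inf "f q"]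
        by (simp add: G_def)
      then have "pmat (G k q) $ 2 $ 2 \<noteq> 0" using \<eta>(2)[of "G k q"] by force
      then show ?thesis
        unfolding G_def by (metis pmat_embed_22_eq_0_iff prod.collapse)
    qed
    have away: "norm (pmat (f q) $ 2 $ 2) > 1 / 4" if "q \<in> cball p r" for q
      using near[OF that] \<eta> by (intro \<eta>(2)) simp
    have contr: "continuous_on (cball p r) f"
      by (rule continuous_on_subset[OF contf]) (auto simp: r_def)
    have lim_chart: "uniform_limit (cball p r) (\<lambda>k q. chart_x (G k q)) (\<lambda>q. chart_x (f q)) sequentially"
        "uniform_limit (cball p r) (\<lambda>k q. chart_y (G k q)) (\<lambda>q. chart_y (f q)) sequentially"
      by (rule uniform_limit_chart[OF limG contr compact_cball]; use away in force)+
    have "f q = pt_inf" if q: "q \<in> ball p r" for q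
    proof -
      \<comment> \<open>The complex line from \<open>a\<close> to \<open>q\<close>; the parameter 0 lies in the preimage of \<open>W\<close>.\<close>
      define \<l> where "\<l> = (\<lambda>t. (fst a + t * (fst q - fst a), snd a + t * (snd q - snd a)))"
      define \<Omega> where "\<Omega> = \<l> -` ball p r"
      have cont_l: "continuous_on S \<l>" for S unfolding \<l>_def by (intro continuous_intros)
      have op: "open \<Omega>" unfolding \<Omega>_def
        using continuous_on_open_vimage[of UNIV \<l>] cont_l by auto
      have "convex \<Omega>"
        unfolding convex_alt
      proof (intro ballI allI impI)
        fix s t and u :: real assume *: "s \<in> \<Omega>" "t \<in> \<Omega>" "0 \<le> u \<and> u \<le> 1"
        have "\<l> ((1 - u) *\<^sub>R s + u *\<^sub>R t) = (1 - u) *\<^sub>R \<l> s + u *\<^sub>R \<l> t"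
          by (simp add: \<l>_def scaleR_conv_of_real algebra_simps)
        also have "\<dots> \<in> ball p r"
          using convexD_alt[OF convex_ball, of "\<l> s" p r "\<l> t" u] * by (simp add: \<Omega>_def)
        finally show "(1 - u) *\<^sub>R s + u *\<^sub>R t \<in> \<Omega>" by (simp add: \<Omega>_def)
      qed
      then have conn: "connected \<Omega>" by (rule convex_connected)
      have l0: "\<l> 0 = a" "\<l> 1 = q" by (simp_all add: \<l>_def)
      then have mem: "0 \<in> \<Omega>" "1 \<in> \<Omega>" using a q by (simp_all add: \<Omega>_def)
      have "open (\<Omega> \<inter> \<l> -` W)"
        using op W(1) continuous_on_open_vimage[of UNIV \<l>] cont_l by auto
      then have "interior (\<Omega> \<inter> \<l> -` W) = \<Omega> \<inter> \<l> -` W" by (rule interior_open)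
      then have lp: "0 islimpt \<Omega> \<inter> \<l> -` W"
        using mem l0 a by (intro interior_limit_point) (metis IntI vimageI)
      have transfer: "h (f q) = c"
        if hol: "\<And>k. (\<lambda>t. h (G k (\<l> t))) holomorphic_on \<Omega>"
          and ul: "uniform_limit (cball p r) (\<lambda>k q. h (G k q)) (\<lambda>q. h (f q)) sequentially"
          and c: "h pt_inf = c"
        for h :: "proj_plane \<Rightarrow> complex" and c
      proof -
        have "(\<lambda>t. h (f (\<l> t))) holomorphic_on \<Omega>"
        proof (rule holomorphic_uniform_sequence[OF op hol])
          fix t assume "t \<in> \<Omega>"
          then obtain e where e: "e > 0" "cball t e \<subseteq> \<Omega>" using op open_contains_cball by blast
          have "uniform_limit (cball t e) (\<lambda>k t. h (G k (\<l> t))) (\<lambda>t. h (f (\<l> t))) sequentially"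
            by (rule uniform_limit_compose'[OF ul]) (use e in \<open>auto simp: \<Omega>_def\<close>)
          then show "\<exists>d>0. cball t d \<subseteq> \<Omega> \<and>
              uniform_limit (cball t d) (\<lambda>k t. h (G k (\<l> t))) (\<lambda>t. h (f (\<l> t))) sequentially"
            using e by blast
        qed
        then have "(\<lambda>t. h (f (\<l> t)) - c) holomorphic_on \<Omega>" by (intro holomorphic_intros)
        then have "h (f (\<l> 1)) - c = 0"
          by (rule analytic_continuation[OF _ op conn Int_lower1 mem(1) lp _ mem(2)])
             (simp add: W(3) c)
        then show ?thesis by (simp add: l0)
      qed
      have hol: "(\<lambda>t. fst ((F_map ^^ n) (\<l> t))) holomorphic_on \<Omega>"
        "(\<lambda>t. snd ((F_map ^^ n) (\<l> t))) holomorphic_on \<Omega>" for n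
        unfolding \<l>_def by (intro holomorphic_on_F_map_funpow holomorphic_intros)+
      have nz': "snd ((F_map ^^ m (k + k0)) (\<l> t)) \<noteq> 0" if "t \<in> \<Omega>" for k t
        using that nz[of "\<l> t"] by (auto simp: \<Omega>_def)
      have chartG: "chart_x (G k q) = fst ((F_map ^^ m (k + k0)) q) / snd ((F_map ^^ m (k + k0)) q)"
        "chart_y (G k q) = 1 / snd ((F_map ^^ m (k + k0)) q)" for k q
        unfolding G_def by (metis chart_embed prod.collapse)+
      have "chart_x (f q) = 1"
        by (rule transfer[OF _ lim_chart(1) chart_pt_inf(1)])
           (unfold chartG, intro holomorphic_intros hol nz')
      moreover have "chart_y (f q) = 0"
        by (rule transfer[OF _ lim_chart(2) chart_pt_inf(2)])
           (unfold chartG, intro holomorphic_intros hol nz')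
      ultimately show ?thesis
        using away[of q] q by (intro pt_inf_if_chart) auto
    qed
    then have "ball p r \<subseteq> W"
      unfolding W_def using r by (intro interior_maximal) auto
    then show "p \<in> W" using r(1) by auto
  qed
  moreover have "openin (top_of_set U) W" using W by (intro open_subset)
  ultimately have "W = U"
    using U(2) V \<open>V \<subseteq> W\<close> unfolding connected_clopen by blast
  then show ?thesis using W(3) \<open>p \<in> U\<close> by blast
qed

lemma open_L_dom: "open L_dom"
proof -
  have eq: "L_dom = {p. Re (fst p) + 1 < Re (snd p)} \<inter> {p. 1 < Re (fst p)}"
    by (auto simp: L_dom_iff)
  show ?thesis unfolding eq by (intro open_Int open_Collect_less continuous_intros)
qed

text \<open>If convergence failed along a subsequence, normality would produce a further
subsequence converging to a limit map, which is constant since it is constant on \<open>L_dom\<close>.\<close>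

lemma component_uniform_limit:
  assumes U: "fatou_component F_map U" and L: "L_dom \<subseteq> U" and K: "compact K" "K \<subseteq> U"
  shows "uniform_limit K (\<lambda>n. embed \<circ> F_map ^^ n) (\<lambda>_. pt_inf) sequentially"
proof (rule ccontr)
  have comp: "U \<in> components (fatou_set F_map)" using U by (simp add: fatou_component_def)
  then have U': "open U" "connected U" "U \<subseteq> fatou_set F_map"
    using open_components[OF open_fatou_set comp] in_components_connected[OF comp]
      in_components_subset[OF comp] by simp_all
  assume "\<not> uniform_limit K (\<lambda>n. embed \<circ> F_map ^^ n) (\<lambda>_. pt_inf) sequentially"
  then obtain e where e: "e > 0"
    "\<not> (\<forall>\<^sub>F n in sequentially. \<forall>p\<in>K. dist ((embed \<circ> F_map ^^ n) p) pt_inf < e)"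
    unfolding uniform_limit_iff by blast
  from e(2) have "infinite {n. \<not> (\<forall>p\<in>K. dist ((embed \<circ> F_map ^^ n) p) pt_inf < e)}"
    unfolding cofinite_eq_sequentially[symmetric] eventually_cofinite .
  from infinite_enumerate[OF this] obtain s :: "nat \<Rightarrow> nat" where s: "strict_mono s"
    "\<And>n. \<not> (\<forall>p\<in>K. dist ((embed \<circ> F_map ^^ s n) p) pt_inf < e)" by auto
  have "range (\<lambda>n. embed \<circ> F_map ^^ s n) \<subseteq> iterates F_map" by (auto simp: iterates_def)
  from normal_on_fatou_set[unfolded normal_on_def, rule_format, OF this]
  obtain r g where r: "strict_mono (r :: nat \<Rightarrow> nat)" and g: "\<And>K. compact K \<Longrightarrow> K \<subseteq> fatou_set F_map \<Longrightarrow>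
    uniform_limit K (\<lambda>n. embed \<circ> F_map ^^ s (r n)) g sequentially" by blast
  have "g p = pt_inf" if "p \<in> U" for p
  proof (rule limit_constant_if_locally_constant[OF U'(1,2) open_L_dom _ L _ _ that])
    have "(2, 4) \<in> L_dom" by (simp add: L_dom_iff)
    then show "L_dom \<noteq> {}" by blast
    show "uniform_limit K (\<lambda>n. embed \<circ> F_map ^^ s (r n)) g sequentially"
      if "compact K" "K \<subseteq> U" for K using g that U'(3) by blast
    fix p assume p: "p \<in> L_dom"
    have "p \<in> basin" using p UN_upper[of 0 UNIV "\<lambda>n. (F_map ^^ n) -` L_dom"]
      by (auto simp: basin_def)
    then have "uniform_limit {p} (\<lambda>n. embed \<circ> F_map ^^ n) (\<lambda>_. pt_inf) sequentially"
      by (intro basin_uniform_limit) auto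
    then have "(\<lambda>n. (embed \<circ> F_map ^^ n) p) \<longlonglongrightarrow> pt_inf" by simp
    from LIMSEQ_subseq_LIMSEQ[OF this strict_mono_o[OF s(1) r]]
    have "(\<lambda>n. (embed \<circ> F_map ^^ s (r n)) p) \<longlonglongrightarrow> pt_inf" by (simp add: comp_def)
    moreover have "uniform_limit {p} (\<lambda>n. embed \<circ> F_map ^^ s (r n)) g sequentially"
      using p L U'(3) by (intro g) auto
    then have "(\<lambda>n. (embed \<circ> F_map ^^ s (r n)) p) \<longlonglongrightarrow> g p" by simp
    ultimately show "g p = pt_inf" by (rule LIMSEQ_unique[symmetric])
  qed
  then have gK: "g p = pt_inf" if "p \<in> K" for p using that K(2) by blast
  have "uniform_limit K (\<lambda>n. embed \<circ> F_map ^^ s (r n)) g sequentially"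
    using K U'(3) by (intro g) auto
  from uniform_limitD[OF this e(1)]
  have "\<forall>\<^sub>F n in sequentially. \<forall>p\<in>K. dist ((embed \<circ> F_map ^^ s (r n)) p) pt_inf < e"
    by (rule eventually_mono) (simp add: gK)
  then show False using s(2) by (auto simp: eventually_sequentially)
qed

section \<open>Escape of the second coordinate\<close>

lemma gmap_eq: "gmap w = 2 * w + 1 + exp (- 2 * w)"
  by (simp add: gmap_def kmap_def)

lemma snd_F_map_funpow: "snd ((F_map ^^ n) p) = (gmap ^^ n) (snd p)"
proof (induction n)
  case (Suc n)
  then show ?case by (cases "(F_map ^^ n) p") (simp add: F_map_eq)
qed simp

text \<open>With \<open>q = exp (- 2 w)\<close>, the derivative of \<open>gmap\<close> at \<open>w\<close> is \<open>2 (1 - q)\<close>, and the hypothesis reads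
\<open>Re q \<le> ln \<bar>q\<bar>\<close> because \<open>- 2 Re w = ln \<bar>q\<bar>\<close>. Both bounds follow from \<open>ln t \<le> t - 1\<close>. Thus
\<open>gmap\<close> expands by a factor at least \<open>2 sqrt 2\<close> along orbits that never enter \<open>Re w > 1\<close>.\<close>

lemma gmap_expanding:
  assumes "Re (gmap w) \<le> 1"
  shows "1 / 2 \<le> norm (exp (- 2 * w))" and "2 \<le> (norm (1 - exp (- 2 * w)))\<^sup>2"
proof -
  define q where "q = exp (- 2 * w)"
  define t where "t = norm q"
  have t: "t > 0" "ln t = - 2 * Re w" by (simp_all add: t_def q_def)
  have re: "Re q \<le> ln t" using assms t(2) by (simp add: gmap_eq q_def)
  have "- t \<le> Re q" using abs_Re_le_cmod[of q] by (simp add: t_def)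
  moreover have "ln t \<le> t - 1" using t(1) by (rule ln_le_minus_one)
  ultimately have "1 / 2 \<le> t" using re by linarith
  then show "1 / 2 \<le> norm (exp (- 2 * w))" by (simp add: t_def q_def)
  have "2 * ln t = ln (t\<^sup>2)" using t(1) by (simp add: ln_realpow)
  also have "\<dots> \<le> t\<^sup>2 - 1" using t(1) by (intro ln_le_minus_one) simp
  finally have "2 * Re q \<le> t\<^sup>2 - 1" using re by linarith
  moreover have "(norm (1 - q))\<^sup>2 = 1 - 2 * Re q + t\<^sup>2"
    by (simp add: t_def cmod_power2) (simp add: power2_eq_square algebra_simps)
  ultimately show "2 \<le> (norm (1 - exp (- 2 * w)))\<^sup>2" by (simp add: q_def)
qed

lemma gmap_funpow_derivative:
  "(gmap ^^ n has_field_derivative (\<Prod>k<n. 2 * (1 - exp (- 2 * (gmap ^^ k) w)))) (at w)"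
proof (induction n)
  case (Suc n)
  have "(gmap has_field_derivative 2 * (1 - exp (- 2 * v))) (at v)" for v
    unfolding gmap_eq[abs_def] by (auto intro!: derivative_eq_intros)
  from DERIV_chain[OF this Suc] show ?case by (simp add: mult_ac comp_def)
qed (auto intro!: derivative_eq_intros simp: id_def)

lemma step_ratio_derivative:
  fixes f :: "complex \<Rightarrow> complex"
  assumes f: "(f has_field_derivative d) (at v)" and nz: "2 * f v + 1 \<noteq> 0"
  shows "((\<lambda>w. 1 + exp (- 2 * f w) / (2 * f w + 1)) has_field_derivative
    - (4 * d * exp (- 2 * f v) * (f v + 1) / (2 * f v + 1)\<^sup>2)) (at v)"
proof -
  have num: "((\<lambda>w. exp (- 2 * f w)) has_field_derivative exp (- 2 * f v) * (- 2 * d)) (at v)"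
    by (rule DERIV_fun_exp DERIV_cmult f)+
  have den: "((\<lambda>w. 2 * f w + 1) has_field_derivative 2 * d + 0) (at v)"
    by (intro DERIV_add DERIV_cmult DERIV_const f)
  have "((\<lambda>w. 1 + exp (- 2 * f w) / (2 * f w + 1)) has_field_derivative
      0 + (exp (- 2 * f v) * (- 2 * d) * (2 * f v + 1) - exp (- 2 * f v) * (2 * d + 0))
        / ((2 * f v + 1) * (2 * f v + 1))) (at v)"
    by (intro DERIV_add[OF DERIV_const] DERIV_divide num den nz)
  moreover have "0 + (exp (- 2 * f v) * (- 2 * d) * (2 * f v + 1) - exp (- 2 * f v) * (2 * d + 0))
        / ((2 * f v + 1) * (2 * f v + 1))
      = - (4 * d * exp (- 2 * f v) * (f v + 1)) / (2 * f v + 1)\<^sup>2"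
    unfolding power2_eq_square add_0 by (rule arg_cong2[where f = "(/)"]) (simp_all add: algebra_simps)
  ultimately show ?thesis by simp
qed

lemma gmap_funpow_holomorphic: "gmap ^^ n holomorphic_on S"
  using gmap_funpow_derivative[of n] field_differentiable_def field_differentiable_at_within
  unfolding holomorphic_on_def by blast

lemma Schottky_cball:
  assumes hol: "h holomorphic_on cball u \<rho>" and "\<rho> > 0" and u: "norm (h u) \<le> 2"
    and omit: "\<And>z. z \<in> cball u \<rho> \<Longrightarrow> h z \<noteq> 0 \<and> h z \<noteq> 1"
    and z: "z \<in> cball u (\<rho> / 2)"
  shows "norm (h z) \<le> exp (pi * exp (pi * 18))"
proof -
  define \<phi> where "\<phi> = (\<lambda>s. u + of_real \<rho> * s)"
  have \<phi>: "\<phi> s \<in> cball u \<rho>" if "s \<in> cball 0 1" for s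
    using that \<open>\<rho> > 0\<close> by (simp add: \<phi>_def dist_norm norm_mult mult_left_le)
  define s where "s = (z - u) / of_real \<rho>"
  have s: "\<phi> s = z" "norm s \<le> 1 / 2"
    using z \<open>\<rho> > 0\<close> by (simp_all add: s_def \<phi>_def norm_divide dist_norm field_simps norm_minus_commute)
  have "norm ((h \<circ> \<phi>) s) \<le> exp (pi * exp (pi * (2 + 2 * 2 + 12 * (1 / 2) / (1 - 1 / 2))))"
  proof (rule Schottky[where f = "h \<circ> \<phi>" and z = s and r = 2])
    have "\<phi> holomorphic_on cball 0 1" unfolding \<phi>_def by (intro holomorphic_intros)
    then show "(h \<circ> \<phi>) holomorphic_on cball 0 1"
      by (rule holomorphic_on_compose_gen[OF _ hol]) (use \<phi> in blast)
  qed (use u s omit[OF \<phi>] in \<open>auto simp: \<phi>_def\<close>)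
  then show ?thesis by (simp add: s)
qed

lemma Re_gmap_funpow_ge:
  assumes "1 < Re ((gmap ^^ m) w)"
  shows "2 ^ n \<le> Re ((gmap ^^ (n + m)) w)"
proof (induction n)
  case (Suc n)
  have "(0 :: real) \<le> 2 ^ n" by simp
  then have "0 \<le> Re ((gmap ^^ (n + m)) w)" using Suc by (rule order_trans)
  then show ?case using Re_gmap_ge[of "(gmap ^^ (n + m)) w"] Suc by simp
qed (use assms in simp)

text \<open>Let \<open>f\<^sub>n\<close> be the iterates of \<open>gmap\<close>. When they are all large on a disc, the ratio
\<open>T = f\<^sub>n\<^sub>+\<^sub>1 / (2 f\<^sub>n + 1) = 1 + exp (- 2 f\<^sub>n) / (2 f\<^sub>n + 1)\<close> omits 0 and 1 there. At an escaping point
near the centre \<open>v\<close> it has modulus at most 2 for large \<open>n\<close>, so Schottky's theorem bounds it near \<open>v\<close>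
independently of \<open>n\<close>, and Cauchy's inequality bounds \<open>T'\<close> at \<open>v\<close>. If \<open>v\<close> never escapes, then
\<open>\<bar>exp (- 2 f\<^sub>n v)\<bar> \<ge> 1 / 2\<close>, and the bound on \<open>T'\<close> becomes a bound on \<open>f\<^sub>n' / f\<^sub>n\<close> at \<open>v\<close>. But
expansion along the orbit of \<open>v\<close> makes this logarithmic derivative grow exponentially.\<close>

lemma escapes_if_in_closure_of_escaping:
  assumes \<rho>: "\<rho> > 0" and large: "\<And>n w. n \<ge> N \<Longrightarrow> w \<in> cball v \<rho> \<Longrightarrow> 10 \<le> norm ((gmap ^^ n) w)"
    and v: "v \<in> closure {w. \<exists>n. 1 < Re ((gmap ^^ n) w)}"
  shows "\<exists>n. 1 < Re ((gmap ^^ n) v)"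
proof (rule ccontr)
  assume "\<nexists>n. 1 < Re ((gmap ^^ n) v)"
  then have left: "Re ((gmap ^^ n) v) \<le> 1" for n by (simp add: not_less)
  obtain u m where u: "dist u v < \<rho> / 8" and m: "1 < Re ((gmap ^^ m) u)"
    using v[unfolded closure_approachable, rule_format, of "\<rho> / 8"] \<rho> by auto
  have sub: "cball u (\<rho> / 2) \<subseteq> cball v \<rho>"
    using u \<rho> by (simp add: cball_subset_cball_iff)
  have sub': "cball v (\<rho> / 8) \<subseteq> cball u (\<rho> / 2 / 2)"
    using u \<rho> by (simp add: cball_subset_cball_iff dist_commute)
  define x where "x = (\<lambda>n. (gmap ^^ n) v)"
  define q where "q = (\<lambda>n. exp (- 2 * x n))"
  define D where "D = (\<lambda>n. \<Prod>k<n. 2 * (1 - q k))"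
  have x_Suc: "x (Suc n) = 2 * x n + 1 + q n" for n by (simp add: x_def q_def gmap_eq)
  have D_Suc: "D (Suc n) = 2 * (1 - q n) * D n" for n by (simp add: D_def mult_ac)
  have q: "1 / 2 \<le> norm (q n)" "2 \<le> (norm (1 - q n))\<^sup>2" for n
    using gmap_expanding[of "x n"] left[of "Suc n"] by (simp_all add: x_def q_def)
  have a: "7 / 5 \<le> norm (1 - q n)" for n
  proof (rule power2_le_imp_le)
    have "(7 / 5 :: real)\<^sup>2 \<le> 2" by (simp add: power2_eq_square)
    then show "(7 / 5)\<^sup>2 \<le> (norm (1 - q n))\<^sup>2" using q(2)[of n] by linarith
  qed simp
  have "1 - q n \<noteq> 0" for n using a[of n] by force
  then have D0: "D n \<noteq> 0" for n by (simp add: D_def)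
  have x10: "10 \<le> norm (x n)" if "n \<ge> N" for n
    using large[OF that, of v] \<rho> by (simp add: x_def)
  define C where "C = exp (pi * exp (pi * 18)) / (\<rho> / 8)"
  have upper: "norm (D n) \<le> 5 * C * norm (x n)" if n: "n \<ge> max N m" for n
  proof -
    define T where "T = (\<lambda>w. 1 + exp (- 2 * (gmap ^^ n) w) / (2 * (gmap ^^ n) w + 1))"
    have den: "1 \<le> norm (2 * (gmap ^^ n) w + 1)" "2 * (gmap ^^ n) w + 1 \<noteq> 0"
      if "w \<in> cball v \<rho>" for w
    proof -
      have "norm (2 * (gmap ^^ n) w) \<le> norm (2 * (gmap ^^ n) w + 1) + norm (1 :: complex)"
        using norm_triangle_ineq4[of "2 * (gmap ^^ n) w + 1" 1] by simp
      then show "1 \<le> norm (2 * (gmap ^^ n) w + 1)"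
        using large[of n w] n that by (simp add: norm_mult)
      then show "2 * (gmap ^^ n) w + 1 \<noteq> 0" by auto
    qed
    have holT: "T holomorphic_on S" if "S \<subseteq> cball v \<rho>" for S
      unfolding T_def using den that by (intro holomorphic_intros gmap_funpow_holomorphic) auto
    have omit: "T w \<noteq> 0 \<and> T w \<noteq> 1" if w: "w \<in> cball u (\<rho> / 2)" for w
    proof -
      have w': "w \<in> cball v \<rho>" using w sub by blast
      have "T w = (gmap ^^ Suc n) w / (2 * (gmap ^^ n) w + 1)"
        using den(2)[OF w'] by (simp add: T_def gmap_eq field_simps)
      moreover have "(gmap ^^ Suc n) w \<noteq> 0"
        using large[of "Suc n" w] n w' by force
      ultimately have "T w \<noteq> 0" using den(2)[OF w'] by simp
      moreover have "T w \<noteq> 1" using den(2)[OF w'] by (simp add: T_def)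
      ultimately show ?thesis by blast
    qed
    have "norm (T u) \<le> 2"
    proof -
      have "u \<in> cball v \<rho>" using u \<rho> by (simp add: dist_commute)
      then have d: "1 \<le> norm (2 * (gmap ^^ n) u + 1)" by (rule den(1))
      have "2 ^ (n - m) \<le> Re ((gmap ^^ n) u)" using Re_gmap_funpow_ge[OF m, of "n - m"] n by simp
      then have "0 \<le> Re ((gmap ^^ n) u)" by (rule order_trans[rotated]) simp
      then have "norm (exp (- 2 * (gmap ^^ n) u)) \<le> 1" by simp
      then have "norm (exp (- 2 * (gmap ^^ n) u)) / norm (2 * (gmap ^^ n) u + 1) \<le> 1"
        using d by (intro divide_le_eq_1_pos[THEN iffD2]) linarith+
      then show ?thesis
        using norm_triangle_ineq[of 1 "exp (- 2 * (gmap ^^ n) u) / (2 * (gmap ^^ n) u + 1)"]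
        unfolding T_def norm_divide norm_one by linarith
    qed
    \<comment> \<open>The same bound for all \<open>n\<close>: Schottky on a disc about \<open>u\<close> that contains a disc about \<open>v\<close>.\<close>
    then have bound: "norm (T w) \<le> exp (pi * exp (pi * 18))" if "w \<in> cball v (\<rho> / 8)" for w
      using Schottky_cball[OF holT[OF sub], of w] omit \<rho> sub' that by auto
    have sub8: "cball v (\<rho> / 8) \<subseteq> cball v \<rho>" using \<rho> by auto
    have "norm ((deriv ^^ 1) T v) \<le> fact 1 * exp (pi * exp (pi * 18)) / (\<rho> / 8) ^ 1"
    proof (rule Cauchy_inequality)
      show "T holomorphic_on ball v (\<rho> / 8)"
        using sub8 ball_subset_cball by (intro holT) blast
      show "continuous_on (cball v (\<rho> / 8)) T"
        using sub8 by (intro holomorphic_on_imp_continuous_on holT)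
      show "norm (T w) \<le> exp (pi * exp (pi * 18))" if "norm (v - w) = \<rho> / 8" for w
        using that by (intro bound) (simp add: dist_norm)
    qed (use \<rho> in simp)
    then have dC: "norm (deriv T v) \<le> C" by (simp add: C_def)
    have vin: "v \<in> cball v \<rho>" using \<rho> by simp
    have xn: "10 \<le> norm (x n)" using n by (intro x10) simp
    have nz: "2 * x n + 1 \<noteq> 0" using den(2)[OF vin] by (simp add: x_def)
    have "(gmap ^^ n has_field_derivative D n) (at v)"
      unfolding D_def q_def x_def by (rule gmap_funpow_derivative)
    then have "(T has_field_derivative - (4 * D n * q n * (x n + 1) / (2 * x n + 1)\<^sup>2)) (at v)"
      using nz unfolding T_def q_def x_def by (rule step_ratio_derivative)
    then have "deriv T v = - (4 * D n * q n * (x n + 1) / (2 * x n + 1)\<^sup>2)"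
      by (rule DERIV_imp_deriv)
    then have dT: "norm (deriv T v) * (norm (2 * x n + 1))\<^sup>2 = 4 * norm (D n) * norm (q n) * norm (x n + 1)"
      using nz by (simp add: norm_mult norm_divide norm_power)
    define X where "X = norm (x n)"
    have X: "10 \<le> X" using xn by (simp add: X_def)
    have "norm (x n) \<le> norm (x n + 1) + norm (1 :: complex)"
      using norm_triangle_ineq4[of "x n + 1" 1] by simp
    then have l: "X / 2 \<le> norm (x n + 1)" using X by (simp add: X_def)
    have "norm (2 * x n + 1) \<le> norm (2 * x n) + norm (1 :: complex)" by (rule norm_triangle_ineq)
    then have "norm (2 * x n + 1) \<le> 2 * X + 1" by (simp add: X_def norm_mult)
    also have "\<dots> \<le> 11 / 5 * X" using X by simp
    finally have h: "(norm (2 * x n + 1))\<^sup>2 \<le> (11 / 5 * X)\<^sup>2" by (intro power_mono) auto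
    have "C \<ge> 0" using \<rho> by (simp add: C_def)
    have "4 * norm (D n) * (1 / 2) * (X / 2) \<le> 4 * norm (D n) * norm (q n) * norm (x n + 1)"
      using l q(1)[of n] X by (intro mult_mono) auto
    also have "\<dots> \<le> C * (11 / 5 * X)\<^sup>2"
      unfolding dT[symmetric] using dC h by (intro mult_mono) (auto intro: order_trans[OF norm_ge_zero])
    also have "\<dots> \<le> C * (5 * X\<^sup>2)" using \<open>C \<ge> 0\<close> by (intro mult_left_mono) (simp_all add: power2_eq_square)
    finally have "norm (D n) * X \<le> (5 * C * X) * X" by (simp add: power2_eq_square)
    then show ?thesis unfolding X_def[symmetric] by (rule mult_right_le_imp_le) (use X in simp)
  qed
  \<comment> \<open>One step multiplies the derivative by \<open>2 \<bar>1 - q\<bar>\<close> but the point by at most \<open>2 + (1 + \<bar>q\<bar>) / \<bar>x\<bar>\<close>.\<close>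
  have grow: "11 / 10 * (norm (D n) / norm (x n)) \<le> norm (D (Suc n)) / norm (x (Suc n))"
    if n: "n \<ge> N" for n
  proof -
    define X b where "X = norm (x n)" and "b = norm (1 - q n)"
    have X: "10 \<le> X" "10 \<le> norm (x (Suc n))" using x10[OF n] x10[of "Suc n"] n by (auto simp: X_def)
    have b: "7 / 5 \<le> b" using a by (simp add: b_def)
    have "norm (q n) \<le> 1 + b" using norm_triangle_ineq4[of 1 "1 - q n"] by (simp add: b_def)
    moreover have "norm (x (Suc n)) \<le> norm (2 * x n + 1) + norm (q n)"
      unfolding x_Suc by (rule norm_triangle_ineq)
    moreover have "norm (2 * x n + 1) \<le> 2 * X + 1"
      using norm_triangle_ineq[of "2 * x n" 1] by (simp add: X_def norm_mult)
    ultimately have "norm (x (Suc n)) \<le> 2 * X + 2 + b" by linarith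
    moreover have "7 / 5 * (2 * X - 11 / 10) \<le> b * (2 * X - 11 / 10)"
      using b X by (intro mult_right_mono) auto
    then have "11 / 10 * (2 * X + 2 + b) \<le> 2 * b * X" using X(1) by (simp add: algebra_simps)
    ultimately have "11 / 10 * norm (x (Suc n)) \<le> 2 * b * X" by argo
    then have "11 / 10 * norm (x (Suc n)) * norm (D n) \<le> 2 * b * X * norm (D n)"
      by (intro mult_right_mono) auto
    also have "\<dots> = norm (D (Suc n)) * X" unfolding D_Suc norm_mult by (simp add: b_def)
    finally have fin: "11 / 10 * norm (x (Suc n)) * norm (D n) \<le> norm (D (Suc n)) * X" .
    define Y where "Y = norm (x (Suc n))"
    have "0 < X" "0 < Y" using X unfolding Y_def by linarith+
    then show ?thesis
      using fin unfolding X_def[symmetric] Y_def[symmetric] by (simp add: field_simps)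
  qed
  define k where "k = max N m"
  define c where "c = norm (D k) / norm (x k)"
  have pos: "norm (x (n + k)) > 0" for n using x10[of "n + k"] unfolding k_def by linarith
  from this[of 0] have "norm (x k) > 0" by simp
  then have c: "c > 0" using D0[of k] by (simp add: c_def)
  have "(11 / 10) ^ n * c \<le> norm (D (n + k)) / norm (x (n + k))" for n
  proof (induction n)
    case (Suc n)
    have "(11 / 10) ^ Suc n * c = 11 / 10 * ((11 / 10) ^ n * c)" by simp
    also have "\<dots> \<le> 11 / 10 * (norm (D (n + k)) / norm (x (n + k)))"
      by (intro mult_left_mono Suc) simp
    also have "\<dots> \<le> norm (D (Suc n + k)) / norm (x (Suc n + k))"
      using grow[of "n + k"] by (simp add: k_def)
    finally show ?case .
  qed (simp add: c_def)
  moreover have "norm (D (n + k)) / norm (x (n + k)) \<le> 5 * C" for n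
    using upper[of "n + k"] pos[of n] by (intro divide_le_eq[THEN iffD2]) (simp add: k_def)
  ultimately have le: "(11 / 10) ^ n * c \<le> 5 * C" for n using order_trans by blast
  obtain n where "5 * C / c < (11 / 10) ^ n"
    using real_arch_pow[of "11 / 10" "5 * C / c"] by auto
  then have "5 * C < (11 / 10) ^ n * c" using c by (simp only: pos_divide_less_eq)
  then show False using le[of n] by linarith
qed

text \<open>Every point of the component whose second coordinate is a limit of
escaping points is escaping, so the escaping part is open and closed in the component.\<close>

lemma component_escapes:
  assumes U: "fatou_component F_map U" and L: "L_dom \<subseteq> U" and "p \<in> U"
  shows "\<exists>n. 1 < Re ((gmap ^^ n) (snd p))"
proof -
  have comp: "U \<in> components (fatou_set F_map)" using U by (simp add: fatou_component_def)
  have U': "open U" "connected U"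
    using open_components[OF open_fatou_set comp] in_components_connected[OF comp] by simp_all
  define B where "B = {w. \<exists>n. 1 < Re ((gmap ^^ n) w)}"
  have "open {w. 1 < Re ((gmap ^^ n) w)}" for n
    by (intro open_Collect_less continuous_intros holomorphic_on_imp_continuous_on
        gmap_funpow_holomorphic)
  moreover have "B = (\<Union>n. {w. 1 < Re ((gmap ^^ n) w)})" by (auto simp: B_def)
  ultimately have "open B" by auto
  then have "open (snd -` B :: (complex \<times> complex) set)" by (rule open_vimage_snd)
  then have "openin (top_of_set U) (U \<inter> snd -` B)" by (simp add: openin_open_Int)
  moreover have "closedin (top_of_set U) (U \<inter> snd -` B)"
    unfolding closedin_limpt
  proof (intro conjI allI impI Int_lower1)
    fix p assume p: "p islimpt U \<inter> snd -` B \<and> p \<in> U"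
    obtain R where R: "R > 0" "cball p R \<subseteq> U" using U'(1) p open_contains_cball by blast
    obtain \<eta> where \<eta>: "\<eta> > 0" "\<And>P. dist P pt_inf < \<eta> \<Longrightarrow> norm (pmat P $ 2 $ 2) > 1 / 4"
      "\<And>P. dist P pt_inf < \<eta> \<Longrightarrow> norm (chart_y P) < 1 / 10"
      using chart_near_pt_inf[of "1 / 10"] by (metis zero_less_divide_1_iff zero_less_numeral)
    obtain N where N: "\<And>n p'. n \<ge> N \<Longrightarrow> p' \<in> cball p R \<Longrightarrow>
        dist (embed ((F_map ^^ n) p')) pt_inf < \<eta>"
      using uniform_limitD[OF component_uniform_limit[OF U L compact_cball R(2)] \<eta>(1)]
      unfolding eventually_sequentially comp_apply by blast
    have "\<exists>n. 1 < Re ((gmap ^^ n) (snd p))"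
    proof (rule escapes_if_in_closure_of_escaping[OF R(1)])
      fix n w assume n: "n \<ge> N" and w: "w \<in> cball (snd p) R"
      have "(fst p, w) \<in> cball p R" using w by (cases p) (simp add: dist_Pair_Pair)
      from N[OF n this] have d: "dist (embed ((F_map ^^ n) (fst p, w))) pt_inf < \<eta>" .
      obtain a b where ab: "(F_map ^^ n) (fst p, w) = (a, b)" by fastforce
      have b: "b = (gmap ^^ n) w" using snd_F_map_funpow[of n "(fst p, w)"] ab by simp
      have "b \<noteq> 0" using \<eta>(2)[OF d] pmat_embed_22_eq_0_iff[of a b] unfolding ab by auto
      moreover have "norm (1 / b) < 1 / 10" using \<eta>(3)[OF d] unfolding ab chart_embed .
      ultimately show "10 \<le> norm ((gmap ^^ n) w)" unfolding b by (simp add: norm_divide field_simps)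
    next
      have "p \<in> closure (U \<inter> snd -` B)" using p by (simp add: closure_def)
      then have "snd p \<in> closure (snd ` (U \<inter> snd -` B))"
        using closure_bounded_linear_image_subset[OF bounded_linear_snd] by blast
      also have "\<dots> \<subseteq> closure B" by (intro closure_mono) auto
      finally show "snd p \<in> closure {w. \<exists>n. 1 < Re ((gmap ^^ n) w)}" by (simp add: B_def)
    qed
    then show "p \<in> U \<inter> snd -` B" using p by (simp add: B_def)
  qed
  moreover have "U \<inter> snd -` B \<noteq> {}"
  proof -
    have "(2, 4) \<in> L_dom" by (simp add: L_dom_iff)
    moreover have "(4 :: complex) \<in> B" by (auto simp: B_def intro!: exI[of _ 0])
    ultimately show ?thesis using L by force
  qed
  ultimately have "U \<inter> snd -` B = U" using U'(2) unfolding connected_clopen by blast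
  then show ?thesis using \<open>p \<in> U\<close> by (auto simp: B_def)
qed

section \<open>The absorbing domain\<close>

lemma component_subset_basin:
  assumes U: "fatou_component F_map U" and L: "L_dom \<subseteq> U"
  shows "U \<subseteq> basin"
proof
  fix p assume p: "p \<in> U"
  define z w where "z = (\<lambda>n. fst ((F_map ^^ n) p))" and "w = (\<lambda>n. (gmap ^^ n) (snd p))"
  have Fn: "(F_map ^^ n) p = (z n, w n)" for n
    unfolding z_def w_def using snd_F_map_funpow[of n p] by (metis prod.collapse)
  obtain m where m: "1 < Re (w m)" using component_escapes[OF U L p] by (auto simp: w_def)
  have re: "2 ^ n \<le> Re (w (n + m))" for n
    using Re_gmap_funpow_ge[of m "snd p" n] m by (simp add: w_def)
  have no: "norm (w (n + m)) + 2 \<le> 2 ^ n * (norm (w m) + 2)" for n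
  proof (induction n)
    case (Suc n)
    have "(0 :: real) \<le> 2 ^ n" by simp
    then have "0 \<le> Re (w (n + m))" using re[of n] by (rule order_trans)
    then have e: "norm (exp (- 2 * w (n + m))) \<le> 1" by simp
    have "w (Suc n + m) = 2 * w (n + m) + 1 + exp (- 2 * w (n + m))" by (simp add: w_def gmap_eq)
    also have "norm \<dots> \<le> norm (2 * w (n + m)) + norm (1 :: complex) + norm (exp (- 2 * w (n + m)))"
      by (intro norm_triangle_mono order_refl)
    finally have "norm (w (Suc n + m)) \<le> 2 * norm (w (n + m)) + 2"
      using e unfolding norm_mult norm_numeral norm_one by linarith
    then show ?case using Suc by simp
  qed simp
  \<comment> \<open>Entry at time \<open>m\<close> gives \<open>\<delta> * norm (w (n + m)) \<le> Re (w (n + m))\<close> for all \<open>n\<close>.\<close>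
  define \<delta> where "\<delta> = 1 / (norm (w m) + 2)"
  have \<delta>: "\<delta> > 0" unfolding \<delta>_def by (simp add: add_nonneg_pos)
  obtain \<eta> where \<eta>: "\<eta> > 0" "\<And>P. dist P pt_inf < \<eta> \<Longrightarrow> norm (chart_x P - 1) < \<delta>"
    using chart_near_pt_inf[OF \<delta>] by metis
  have "uniform_limit {p} (\<lambda>n. embed \<circ> F_map ^^ n) (\<lambda>_. pt_inf) sequentially"
    using p by (intro component_uniform_limit[OF U L]) auto
  from uniform_limitD[OF this \<eta>(1)] obtain n0 where
    "\<And>n. n \<ge> n0 \<Longrightarrow> dist (embed ((F_map ^^ n) p)) pt_inf < \<eta>"
    unfolding eventually_sequentially by auto
  then obtain n where n: "n > 0" "dist (embed ((F_map ^^ (n + m)) p)) pt_inf < \<eta>"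
    using that[of "Suc n0"] by (metis le_add1 le_SucI trans_le_add1 zero_less_Suc le_refl)
  have "norm (z (n + m) / w (n + m) - 1) < \<delta>"
    using \<eta>(2)[OF n(2)] unfolding Fn chart_embed .
  moreover have pos: "(0 :: real) < 2 ^ n" by simp
  then have re0: "0 < Re (w (n + m))" using re[of n] by (rule less_le_trans)
  then have nz: "w (n + m) \<noteq> 0" by auto
  then have "z (n + m) / w (n + m) - 1 = (z (n + m) - w (n + m)) / w (n + m)"
    by (simp add: diff_divide_distrib)
  ultimately have "norm (z (n + m) - w (n + m)) < \<delta> * norm (w (n + m))"
    using nz by (simp add: norm_divide divide_less_eq)
  also have "\<dots> \<le> \<delta> * (2 ^ n * (norm (w m) + 2))"
    using no[of n] \<delta> by (intro mult_left_mono) auto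
  also have "\<dots> = 2 ^ n"
  proof -
    have "norm (w m) + 2 > 0" by (simp add: add_nonneg_pos)
    then show ?thesis by (simp add: \<delta>_def)
  qed
  also have "\<dots> \<le> Re (w (n + m))" by (rule re)
  finally have "0 < Re (z (n + m))"
    using abs_Re_le_cmod[of "z (n + m) - w (n + m)"] by simp
  moreover have "1 < (2 :: real) ^ n" using n(1) by (intro one_less_power) auto
  then have "1 < Re (w (n + m))" using re[of n] by (rule less_le_trans)
  ultimately have "(F_map ^^ (n + m)) p \<in> Q_dom" by (simp add: Fn Q_dom_def)
  then show "p \<in> basin" unfolding basin_eq by blast
qed

theorem lemma4:
  fixes U :: "(complex \<times> complex) set"
  assumes "fatou_component F_map U"
    and "F_map ` U \<subseteq> U"
    and "L_dom \<subseteq> U"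
  shows "U = (\<Union>n. (F_map ^^ n) -` L_dom)"
  using component_subset_basin[OF assms(1,3)] basin_subset_component[OF assms(1,3)]
  unfolding basin_def by (rule equalityI)

end
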